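(* Let $\Omega^{AB}$ be a quantum channel from $A_0B_0$ to $A_1B_1$ such that system $B$ (both $B_0$ and $B_1$) is classical. Then $$P_{\rm guess}(\Omega^{AB})=2^{-H^{\rm ext}_{\min}(B|A)_\Omega}.$$
   Context: All Hilbert spaces are finite-dimensional; $d_S=\dim\mathcal H^S$. Party $A$ has input $A_0$ and output $A_1$, and $A$ as a label of operators means $A_0A_1$ (similarly for $B$). A quantum channel is a completely positive trace-preserving (CPTP) map. $B$ classical means: with respect to fixed orthonormal bases $\{|y\rangle\}_{y=1}^{d_{B_0}}$ of $\mathcal H^{B_0}$ and $\{|x\rangle\}_{x=1}^{d_{B_1}}$ of $\mathcal H^{B_1}$, $$\Omega^{AB}(\rho^{A_0B_0})=\sum_{y=1}^{d_{B_0}}\sum_{x=1}^{d_{B_1}}\Omega_{x|y}^{A_0\to A_1}\big(\langle y|\rho^{A_0B_0}|y\rangle\big)\otimes|x\rangle\langle x|^{B_1},$$ where each $\Omega_{x|y}^{A_0\to A_1}$ is a completely positive map and, for each $y$, $\sum_x\Omega_{x|y}$ is CPTP. Guessing probability: for each $y$, $$P^{(y)}_{\rm guess}(\Omega^{AB})=\max\sum_{x=1}^{d_{B_1}}\mathrm{Tr}\Big[P_x\,\big(\Omega_{x|y}^{A_0\to A_1}\otimes\mathrm{id}^{A_2}\big)\big(|\eta\rangle\langle\eta|^{A_0A_2}\big)\Big],$$ the maximum being over all POVMs $\{P_x\}_{x=1}^{d_{B_1}}$ on $A_1A_2$ and all normalized pure states $|\eta\rangle$ on $A_0A_2$ (with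 $A_2$ an auxiliary finite-dimensional system, which can be taken of dimension at most $d_{A_0}$); and $$P_{\rm guess}(\Omega^{AB})=\frac1{d_{B_0}}\sum_{y=1}^{d_{B_0}}P^{(y)}_{\rm guess}(\Omega^{AB}).$$ Extended conditional min-entropy: let $\omega^{AB}=\frac1{d_{A_0}d_{B_0}}(\mathrm{id}^{A_0B_0}\otimes\Omega^{\tilde A_0\tilde B_0\to A_1B_1})(\phi_+^{A_0\tilde A_0}\otimes\phi_+^{B_0\tilde B_0})$, where $\phi_+^{S\tilde S}=\sum_{i,j}|i\rangle\langle j|^S\otimes|i\rangle\langle j|^{\tilde S}$ and $\tilde S$ is a copy of $S$. Then $$H^{\rm ext}_{\min}(B|A)_\Omega=-\log_2\min\big\{\mathrm{Tr}[\gamma^{AB_0}]:\ \gamma^{AB_0}\otimes I^{B_1}\ge\omega^{AB},\ \gamma^{A_0B_0}=u^{A_0}\otimes\gamma^{B_0}\big\},$$ the minimum being over Hermitian operators $\gamma^{AB_0}$ on $\mathcal H^{A_0A_1B_0}$, where deleting system labels denotes partial trace and $u^{A_0}=I^{A_0}/d_{A_0}$. *)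

theory Defs
  imports "HOL-Analysis.Analysis"
begin

text \<open>
  A system is a finite index type \<open>'s\<close>, its Hilbert space is \<^typ>\<open>complex ^ 's\<close> with the
  fixed orthonormal basis \<open>axis i 1\<close>, and a composite system has the product index type.
  \<open>M $ i $ j\<close> is the entry of \<open>M\<close> in row \<open>i\<close> and column \<open>j\<close>.
\<close>

type_synonym 's op = "complex ^ 's ^ 's"

definition cip :: "complex ^ 's \<Rightarrow> complex ^ 's \<Rightarrow> complex" where
  "cip v w = (\<Sum>i\<in>UNIV. cnj (v $ i) * w $ i)"

definition outer :: "complex ^ 's \<Rightarrow> complex ^ 's \<Rightarrow> 's::finite op" where
  "outer v w = (\<chi> i j. v $ i * cnj (w $ j))"

definition hermitian :: "'s::finite op \<Rightarrow> bool" where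
  "hermitian M \<longleftrightarrow> (\<chi> i j. cnj (M $ j $ i)) = M"

definition psd :: "'s::finite op \<Rightarrow> bool" where
  "psd M \<longleftrightarrow> (\<forall>v. cip v (M *v v) \<in> \<real>\<^sub>\<ge>\<^sub>0)"

definition op_ge :: "'s::finite op \<Rightarrow> 's op \<Rightarrow> bool" where
  "op_ge M N \<longleftrightarrow> psd (M - N)"

definition kron :: "'s::finite op \<Rightarrow> 't::finite op \<Rightarrow> ('s \<times> 't) op" where
  "kron M N = (\<chi> p q. M $ fst p $ fst q * N $ snd p $ snd q)"

definition reindex :: "('t::finite \<Rightarrow> 's::finite) \<Rightarrow> 's op \<Rightarrow> 't op" where
  "reindex f M = (\<chi> p q. M $ f p $ f q)"

definition ptrace_fst :: "('s::finite \<times> 't::finite) op \<Rightarrow> 't op" where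
  "ptrace_fst M = (\<chi> i j. \<Sum>k\<in>UNIV. M $ (k, i) $ (k, j))"

definition ptrace_snd :: "('s::finite \<times> 't::finite) op \<Rightarrow> 's op" where
  "ptrace_snd M = (\<chi> i j. \<Sum>k\<in>UNIV. M $ (i, k) $ (j, k))"

definition max_mixed :: "'s::finite op" where
  "max_mixed = (1 / real CARD('s)) *\<^sub>R mat 1"

definition phi_plus :: "('s::finite \<times> 's) op" where
  "phi_plus = (\<Sum>i\<in>UNIV. \<Sum>j\<in>UNIV.
     kron (outer (axis i 1) (axis j 1)) (outer (axis i 1) (axis j 1)))"

definition id_tensor :: "('s::finite op \<Rightarrow> 't::finite op) \<Rightarrow> ('r::finite \<times> 's) op \<Rightarrow> ('r \<times> 't) op" where
  "id_tensor \<Phi> X =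
     (\<chi> p q. \<Phi> (\<chi> i j. X $ (fst p, i) $ (fst q, j)) $ snd p $ snd q)"

text \<open>
  Ancillas of arbitrary finite dimension \<open>d\<close>, which cannot be quantified over as types: an
  operator on \<open>H \<otimes> C\<^sup>d\<close> is represented by its \<open>d \<times> d\<close> block matrix
  \<open>X i j = (I \<otimes> \<langle>i|) X (I \<otimes> |j\<rangle>)\<close> and a vector by its components
  \<open>v i = (I \<otimes> \<langle>i|) v\<close>, where \<open>i, j < d\<close>; values at other indices are irrelevant.
\<close>

type_synonym 's bop = "nat \<Rightarrow> nat \<Rightarrow> 's op"

definition bpsd :: "nat \<Rightarrow> 's::finite bop \<Rightarrow> bool" where
  "bpsd d X \<longleftrightarrow> (\<forall>v. (\<Sum>i<d. \<Sum>j<d. cip (v i) (X i j *v v j)) \<in> \<real>\<^sub>\<ge>\<^sub>0)"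

definition btrace_mult :: "nat \<Rightarrow> 's::finite bop \<Rightarrow> 's bop \<Rightarrow> complex" where
  "btrace_mult d X Y = (\<Sum>i<d. \<Sum>j<d. trace (X i j ** Y j i))"

definition bouter :: "(nat \<Rightarrow> complex ^ 's) \<Rightarrow> (nat \<Rightarrow> complex ^ 's) \<Rightarrow> 's::finite bop" where
  "bouter v w = (\<lambda>i j. outer (v i) (w j))"

definition bunit_vector :: "nat \<Rightarrow> (nat \<Rightarrow> complex ^ 's) \<Rightarrow> bool" where
  "bunit_vector d v \<longleftrightarrow> (\<Sum>i<d. (norm (v i))\<^sup>2) = 1"

definition tensor_bid :: "('s::finite op \<Rightarrow> 't::finite op) \<Rightarrow> 's bop \<Rightarrow> 't bop" where
  "tensor_bid \<Phi> X = (\<lambda>i j. \<Phi> (X i j))"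

definition bPOVM :: "nat \<Rightarrow> ('x::finite \<Rightarrow> 's::finite bop) \<Rightarrow> bool" where
  "bPOVM d P \<longleftrightarrow> (\<forall>x. bpsd d (P x)) \<and>
     (\<forall>i<d. \<forall>j<d. (\<Sum>x\<in>UNIV. P x i j) = (if i = j then mat 1 else 0))"

definition clinear_map :: "('s::finite op \<Rightarrow> 't::finite op) \<Rightarrow> bool" where
  "clinear_map \<Phi> \<longleftrightarrow> (\<forall>X Y. \<Phi> (X + Y) = \<Phi> X + \<Phi> Y) \<and>
     (\<forall>c X. \<Phi> (map_matrix ((*) c) X) = map_matrix ((*) c) (\<Phi> X))"

definition completely_positive :: "('s::finite op \<Rightarrow> 't::finite op) \<Rightarrow> bool" where
  "completely_positive \<Phi> \<longleftrightarrow> clinear_map \<Phi> \<and>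
     (\<forall>d X. bpsd d X \<longrightarrow> bpsd d (tensor_bid \<Phi> X))"

definition quantum_channel :: "('s::finite op \<Rightarrow> 't::finite op) \<Rightarrow> bool" where
  "quantum_channel \<Phi> \<longleftrightarrow> completely_positive \<Phi> \<and> (\<forall>X. trace (\<Phi> X) = trace X)"

text \<open>\<open>W x y\<close> is the map \<open>\<Omega>\<close> with index \<open>x|y\<close>; \<open>sandwich y \<rho>\<close> is \<open>\<langle>y|\<rho>|y\<rangle>\<close>.\<close>

definition sandwich :: "'b::finite \<Rightarrow> ('a::finite \<times> 'b) op \<Rightarrow> 'a op" where
  "sandwich y \<rho> = (\<chi> i j. \<rho> $ (i, y) $ (j, y))"

definition B_classical ::
  "(('a0::finite \<times> 'b0::finite) op \<Rightarrow> ('a1::finite \<times> 'b1::finite) op) \<Rightarrow>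
   ('b1 \<Rightarrow> 'b0 \<Rightarrow> 'a0 op \<Rightarrow> 'a1 op) \<Rightarrow> bool" where
  "B_classical \<Omega> W \<longleftrightarrow>
     (\<forall>x y. completely_positive (W x y)) \<and>
     (\<forall>y. quantum_channel (\<lambda>\<rho>. \<Sum>x\<in>UNIV. W x y \<rho>)) \<and>
     (\<forall>\<rho>. \<Omega> \<rho> = (\<Sum>y\<in>UNIV. \<Sum>x\<in>UNIV.
            kron (W x y (sandwich y \<rho>)) (outer (axis x 1) (axis x 1))))"

text \<open>
  Here and in \<open>H_min_ext\<close> the extrema are a genuine maximum and minimum: \<open>GREATEST\<close> and
  \<open>LEAST\<close> are unspecified unless the extremum is attained.
\<close>

definition P_guess_given ::
  "('b1::finite \<Rightarrow> 'b0::finite \<Rightarrow> 'a0::finite op \<Rightarrow> 'a1::finite op) \<Rightarrow> 'b0 \<Rightarrow> real" where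
  "P_guess_given W y =
     (GREATEST p. \<exists>d P \<eta>. bPOVM d P \<and> bunit_vector d \<eta> \<and>
        p = Re (\<Sum>x\<in>UNIV. btrace_mult d (P x) (tensor_bid (W x y) (bouter \<eta> \<eta>))))"

definition P_guess ::
  "('b1::finite \<Rightarrow> 'b0::finite \<Rightarrow> 'a0::finite op \<Rightarrow> 'a1::finite op) \<Rightarrow> real" where
  "P_guess W = 1 / real CARD('b0) * (\<Sum>y\<in>UNIV. P_guess_given W y)"

text \<open>
  The normalised Choi operator of \<open>\<Omega>\<close>, with systems ordered as \<open>((A\<^sub>0 A\<^sub>1) B\<^sub>0) B\<^sub>1\<close>.
\<close>

definition choi_state ::
  "(('a0::finite \<times> 'b0::finite) op \<Rightarrow> ('a1::finite \<times> 'b1::finite) op) \<Rightarrow> ((('a0 \<times> 'a1) \<times> 'b0) \<times> 'b1) op" where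
  "choi_state \<Omega> =
     (1 / (real CARD('a0) * real CARD('b0))) *\<^sub>R
     reindex (\<lambda>(((a0, a1), b0), b1). ((a0, b0), (a1, b1)))
       (id_tensor \<Omega>
         (reindex (\<lambda>((a0, b0), (a0', b0')). ((a0, a0'), (b0, b0')))
           (kron (phi_plus :: ('a0 \<times> 'a0) op) (phi_plus :: ('b0 \<times> 'b0) op))))"

definition marginal_A0B0 :: "(('a0::finite \<times> 'a1::finite) \<times> 'b0::finite) op \<Rightarrow> ('a0 \<times> 'b0) op" where
  "marginal_A0B0 \<gamma> = ptrace_snd (reindex (\<lambda>((a0, b0), a1). ((a0, a1), b0)) \<gamma>)"

definition H_min_ext :: "(('a0::finite \<times> 'b0::finite) op \<Rightarrow> ('a1::finite \<times> 'b1::finite) op) \<Rightarrow> real" where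
  "H_min_ext \<Omega> =
     - log 2 (LEAST t. \<exists>\<gamma> :: (('a0 \<times> 'a1) \<times> 'b0) op.
         hermitian \<gamma> \<and> op_ge (kron \<gamma> (mat 1)) (choi_state \<Omega>) \<and>
         marginal_A0B0 \<gamma> = kron max_mixed (ptrace_fst \<gamma>) \<and>
         t = Re (trace \<gamma>))"

end

theory Submission
  imports Defs
begin

text \<open>
  For fixed \<open>y\<close> let \<open>J\<^sub>x\<close> be the Choi operator of \<open>W x y\<close>. A POVM \<open>P\<close> and a state \<open>\<eta>\<close> yield positive
  operators \<open>Q\<^sub>x\<close> with \<open>\<Sum>\<^sub>x Q\<^sub>x = \<sigma> \<otimes> I\<close>, \<open>tr \<sigma> = 1\<close>, and guessing probability \<open>\<Sum>\<^sub>x tr (J\<^sub>x Q\<^sub>x)\<close>; every such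
  family with \<open>\<sigma>\<close> definite arises in this way from an ancilla isomorphic to \<open>A\<^sub>0\<close>. The dual of this
  semidefinite program minimises \<open>l\<close> subject to \<open>\<gamma> \<ge> J\<^sub>x\<close> and \<open>tr\<^bsub>A1\<^esub> \<gamma> = l I\<close>. Compactness gives an optimal
  \<open>(P, \<eta>)\<close> and separation of convex sets an optimal \<open>\<gamma>\<close> of the same value. As \<open>\<omega>\<close> is block diagonal in
  \<open>y\<close> and \<open>x\<close>, the program defining \<open>H_min_ext\<close> splits, up to the factor \<open>1 / (d\<^bsub>A0\<^esub> d\<^bsub>B0\<^esub>)\<close>, into these dual
  programs, one for each \<open>y\<close>.
\<close>

section \<open>Positive semidefinite operators: rank-one decomposition, factorisation and trace
  pairing\<close>

definition adj :: "complex ^ 'n ^ 'm \<Rightarrow> complex ^ 'm ^ 'n" where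
  "adj M = (\<chi> i j. cnj (M $ j $ i))"

lemma cip_matrix:
  fixes M :: "'s::finite op"
  shows "cip v (M *v w) = (\<Sum>i\<in>UNIV. \<Sum>j\<in>UNIV. cnj (v $ i) * M $ i $ j * w $ j)"
  by (simp add: cip_def matrix_vector_mult_def sum_distrib_left mult.assoc)

lemma cip_axis:
  fixes M :: "'s::finite op"
  shows "cip (axis i 1) (M *v axis j 1) = M $ i $ j"
  by (simp add: cip_def matrix_vector_mult_def axis_def if_distrib if_distribR sum.delta cong: if_cong)

lemma cip_add_left: "cip (u + v) w = cip u w + cip (v :: complex ^ 's::finite) w"
  and cip_add_right: "cip u (v + w) = cip u v + cip u w"
  and cip_scale_left: "cip (c *s u) w = cnj c * cip u w"
  and cip_scale_right: "cip u (c *s w) = c * cip u w"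
  and cip_cnj: "cnj (cip u w) = cip w u"
  by (simp_all add: cip_def distrib_left distrib_right sum.distrib sum_distrib_left mult_ac)

lemma cip_self: "cip v v = of_real ((norm (v :: complex ^ 's::finite))\<^sup>2)"
proof -
  have "(norm v)\<^sup>2 = (\<Sum>i\<in>UNIV. (cmod (v $ i))\<^sup>2)"
    by (simp add: norm_vec_def L2_set_def sum_nonneg)
  then show ?thesis
    by (simp add: cip_def complex_norm_square mult.commute flip: of_real_power)
qed

lemma nonneg_Reals_iff_complex: "z \<in> \<real>\<^sub>\<ge>\<^sub>0 \<longleftrightarrow> Im z = 0 \<and> Re z \<ge> 0"
  by (auto simp: complex_nonneg_Reals_iff)

lemma adj_adj [simp]: "adj (adj M) = M"
  by (simp add: adj_def vec_eq_iff)

lemma adj_mult: "adj (M ** N) = adj N ** adj M"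
  by (simp add: adj_def matrix_matrix_mult_def vec_eq_iff mult.commute)

lemma adj_mat1 [simp]: "adj (mat 1) = mat 1"
  by (simp add: adj_def mat_def vec_eq_iff)

lemma hermitian_iff_adj: "hermitian M \<longleftrightarrow> adj M = M"
  by (simp add: hermitian_def adj_def)

lemma cip_adj: "cip v (M *v w) = cip (adj M *v v) (w :: complex ^ 's::finite)"
  for M :: "complex ^ 's::finite ^ 't::finite"
proof -
  have "cip (adj M *v v) w = (\<Sum>j\<in>UNIV. \<Sum>i\<in>UNIV. cnj (v $ i) * M $ i $ j * w $ j)"
    by (simp add: cip_def matrix_vector_mult_def adj_def sum_distrib_left sum_distrib_right mult_ac)
  also have "\<dots> = cip v (M *v w)"
    by (subst sum.swap) (simp add: cip_def matrix_vector_mult_def sum_distrib_left mult_ac)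
  finally show ?thesis by simp
qed

lemma psd_diag: "psd M \<Longrightarrow> M $ i $ i \<in> \<real>\<^sub>\<ge>\<^sub>0"
  unfolding psd_def using cip_axis[of i M i] by metis

text \<open>Polarisation: the form at \<open>axis i 1 + c *s axis j 1\<close> is real. Taking
  \<open>c = 1\<close> makes the imaginary parts of the entries \<open>(i, j)\<close> and
  \<open>(j, i)\<close> opposite, and \<open>c = \<i>\<close> makes their real parts equal.\<close>

lemma psd_hermitian:
  assumes "psd M"
  shows "hermitian M"
proof -
  have "cnj (M $ j $ i) = M $ i $ j" for i j
  proof -
    have im: "Im (cip v (M *v v)) = 0" for v
      using assms by (simp add: psd_def nonneg_Reals_iff_complex)
    have *: "cip (axis i 1 + c *s axis j 1) (M *v (axis i 1 + c *s axis j 1))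
        = M $ i $ i + c * M $ i $ j + cnj c * M $ j $ i + cnj c * c * M $ j $ j" for c
      by (simp add: matrix_vector_right_distrib matrix_vector_mult_scaleR cip_add_left cip_add_right
          cip_scale_left cip_scale_right cip_axis vec.scale algebra_simps)
    have d: "Im (M $ i $ i) = 0" "Im (M $ j $ j) = 0"
      using psd_diag[OF assms] by (auto simp: nonneg_Reals_iff_complex)
    have "Im (M $ i $ j + M $ j $ i) = 0" using im[of "axis i 1 + 1 *s axis j 1"] d
      unfolding * by simp
    moreover have "Re (M $ i $ j) - Re (M $ j $ i) = 0"
      using im[of "axis i 1 + \<i> *s axis j 1"] d unfolding * by simp
    ultimately show ?thesis by (simp add: complex_eq_iff)
  qed
  then show ?thesis by (simp add: hermitian_def vec_eq_iff)
qed

lemma psd_iff: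
  "psd M \<longleftrightarrow> hermitian M \<and> (\<forall>v. 0 \<le> Re (cip v (M *v v)))"
proof safe
  assume "psd M"
  then show "hermitian M" "0 \<le> Re (cip v (M *v v))" for v
    by (auto simp: psd_hermitian) (auto simp: psd_def nonneg_Reals_iff_complex)
next
  assume h: "hermitian M" and "\<forall>v. 0 \<le> Re (cip v (M *v v))"
  moreover have "Im (cip v (M *v v)) = 0" for v
    using h cip_adj[of v M v] cip_cnj[of "M *v v" v]
    by (metis Reals_cnj_iff complex_is_Real_iff hermitian_iff_adj)
  ultimately show "psd M" by (simp add: psd_def nonneg_Reals_iff_complex)
qed

lemma scaleR_vec_nth: "(r *\<^sub>R v) $ i = of_real r * v $ i"
  for v :: "complex ^ 'n"
  by (simp only: vector_scaleR_component) (simp only: scaleR_conv_of_real)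

lemma scaleR_entry: "(r *\<^sub>R M) $ i $ j = of_real r * M $ i $ j"
  for M :: "complex ^ 'n ^ 'm"
  by (simp only: vector_scaleR_component) (simp only: scaleR_conv_of_real)

lemma cip_matrix_scaleR: "cip u ((r *\<^sub>R M) *v w) = of_real r * cip u (M *v w)"
  for M :: "'s::finite op"
  by (simp only: cip_matrix sum_distrib_left scaleR_entry mult_ac)

lemma cip_matrix_add: "cip u ((M + N) *v w) = cip u (M *v w) + cip u (N *v w)"
  and cip_matrix_diff: "cip u ((M - N) *v w) = cip u (M *v w) - cip u (N *v w)"
  for M :: "'s::finite op"
  unfolding cip_matrix by (simp_all add: algebra_simps sum.distrib sum_subtractf)

lemma psd_0: "psd 0"
  by (simp add: psd_def cip_def)

lemma psd_add: "psd M \<Longrightarrow> psd N \<Longrightarrow> psd (M + N)"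
  by (auto simp: psd_def nonneg_Reals_iff_complex cip_matrix_add)

lemma psd_scaleR: "psd M \<Longrightarrow> 0 \<le> r \<Longrightarrow> psd (r *\<^sub>R M)"
  by (auto simp: psd_def nonneg_Reals_iff_complex cip_matrix_scaleR)

lemma psd_sum: "(\<And>i. i \<in> A \<Longrightarrow> psd (f i)) \<Longrightarrow> psd (sum f A)"
  by (induction A rule: infinite_finite_induct) (auto simp: psd_0 psd_add)

lemma cip_outer: "cip v (outer u w *v z) = cip v u * cip w z"
  unfolding cip_matrix
  by (simp add: outer_def cip_def sum_product mult_ac)

lemma psd_outer: "psd (outer v v)"
proof -
  have "cip w (outer v v *v w) = of_real ((cmod (cip v w))\<^sup>2)" for w
    by (simp only: cip_outer complex_norm_square cip_cnj mult.commute)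
  then show ?thesis by (simp add: psd_def nonneg_Reals_iff_complex)
qed

lemma psd_mat1: "psd (mat 1)"
  by (simp add: psd_def cip_self)

lemma psd_congruence: "psd M \<Longrightarrow> psd (adj A ** M ** A)"
  for A :: "'s::finite op"
  by (simp add: psd_def cip_adj[of _ "adj A"] matrix_vector_mul_assoc[symmetric] matrix_mul_assoc[symmetric])

text \<open>One elimination step of Cholesky type with pivot \<open>k\<close>; \<open>c\<close> is
  column \<open>k\<close> of \<open>M\<close>. Completing the square, the form of the complement at
  \<open>v\<close> is the form of \<open>M\<close> at the minimiser \<open>w\<close> on the complex
  line through \<open>v\<close> in direction \<open>axis k 1\<close>.\<close>

lemma psd_Schur_complement:
  fixes M :: "'s::finite op"
  assumes M: "psd M" and k: "M $ k $ k \<noteq> 0"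
  defines "c \<equiv> M *v axis k 1"
  shows "psd (M - (1 / Re (M $ k $ k)) *\<^sub>R outer c c)"
proof -
  define m where "m = Re (M $ k $ k)"
  have m: "M $ k $ k = of_real m" "m > 0"
    using psd_diag[OF M, of k] k by (auto simp: m_def nonneg_Reals_iff_complex complex_eq_iff)
  have h: "adj M = M" using psd_hermitian[OF M] by (simp add: hermitian_iff_adj)
  have "cip v ((M - (1 / m) *\<^sub>R outer c c) *v v) = cip w (M *v w)"
    if w: "w = v + (- (cip c v / m)) *s axis k 1" for v w
  proof -
    have 1: "cip (axis k 1) (M *v v) = cip c v" by (simp add: cip_adj h c_def)
    have 2: "cip v (M *v axis k 1) = cip v c" by (simp add: c_def)
    have *: "cip (v + d *s axis k 1) (M *v (v + d *s axis k 1))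
        = cip v (M *v v) + d * cip v c + cnj d * cip c v + cnj d * d * m" for d
      by (simp add: matrix_vector_right_distrib cip_add_left cip_add_right cip_scale_left
          cip_scale_right vec.scale cip_axis 1 2 m algebra_simps)
    have "cip w (M *v w) = cip v (M *v v) - (cip c v / m) * cip v c
        - cnj (cip c v / m) * cip c v + cnj (cip c v / m) * (cip c v / m) * m"
      unfolding w * by simp
    also have "\<dots> = cip v (M *v v) - (1 / m) * (cip v c * cip c v)"
      using m by (simp add: cip_cnj field_simps)
    also have "\<dots> = cip v ((M - (1 / m) *\<^sub>R outer c c) *v v)"
      by (simp add: cip_matrix_diff cip_matrix_scaleR cip_outer)
    finally show ?thesis by simp
  qed
  then show ?thesis using M unfolding psd_def m_def by metis
qed

text \<open>The phase \<open>c\<close> turns the two cross terms of the form at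
  \<open>axis i 1 + c *s axis j 1\<close> into \<open>- 2 * cmod (M $ i $ j)\<close>. Consequently a
  zero diagonal forces \<open>M = 0\<close>, and a bounded diagonal bounds every entry.\<close>

lemma psd_entry_bound:
  assumes "psd M"
  shows "2 * cmod (M $ i $ j) \<le> Re (M $ i $ i) + Re (M $ j $ j)"
proof -
  define c where "c = - cis (- Arg (M $ i $ j))"
  have 1: "c * M $ i $ j = - cmod (M $ i $ j)"
  proof -
    have "c * rcis (cmod (M $ i $ j)) (Arg (M $ i $ j)) = - cmod (M $ i $ j)"
      by (simp add: c_def rcis_def mult.left_commute cis_mult)
    then show ?thesis by (simp add: rcis_cmod_Arg)
  qed
  have 2: "cnj c * M $ j $ i = cnj (c * M $ i $ j)"
    using psd_hermitian[OF assms] by (simp add: hermitian_def vec_eq_iff)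
  have 3: "cnj c * c = 1" by (simp add: c_def cis_cnj cis_mult)
  have "cip (axis i 1 + c *s axis j 1) (M *v (axis i 1 + c *s axis j 1))
        = M $ i $ i + c * M $ i $ j + cnj c * M $ j $ i + cnj c * c * M $ j $ j"
      by (simp add: matrix_vector_right_distrib matrix_vector_mult_scaleR cip_add_left cip_add_right
          cip_scale_left cip_scale_right cip_axis vec.scale algebra_simps)
  also have "\<dots> = M $ i $ i + M $ j $ j - 2 * cmod (M $ i $ j)"
    unfolding 3 2 1 by simp
  finally have "0 \<le> Re (M $ i $ i + M $ j $ j - 2 * cmod (M $ i $ j))"
    using assms by (metis psd_iff)
  then show ?thesis by simp
qed

text \<open>Induction on a set \<open>F\<close> containing every index with nonzero diagonal entry.
  Each step splits off one rank-one operator by \<open>psd_Schur_complement\<close> and so clears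
  one more diagonal entry; once the diagonal is zero, \<open>psd_entry_bound\<close> leaves
  nothing.\<close>

lemma psd_sum_outer_aux:
  fixes M :: "'s::finite op"
  assumes "finite F" "psd M" "\<And>i. i \<notin> F \<Longrightarrow> M $ i $ i = 0"
  shows "\<exists>v. M = (\<Sum>i\<in>F. outer (v i) (v i))"
  using assms
proof (induction F arbitrary: M rule: finite_induct)
  case empty
  have "M $ i $ j = 0" for i j
    using psd_entry_bound[OF empty(1), of i j] empty(2) by simp
  then show ?case by (simp add: vec_eq_iff)
next
  case (insert k F)
  \<comment> \<open>At a zero pivot nothing is to be eliminated: \<open>c = 0\<close> gives
    \<open>N = M\<close>, whatever the quotient by the pivot is.\<close>
  define c where "c = (if M $ k $ k = 0 then 0 else M *v axis k 1)"
  define N where "N = M - (1 / Re (M $ k $ k)) *\<^sub>R outer c c"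
  have N: "psd N"
  proof (cases "M $ k $ k = 0")
    case True
    then show ?thesis using insert by (simp add: N_def)
  next
    case False
    then show ?thesis using psd_Schur_complement[OF insert.prems(1), of k] by (simp add: N_def c_def)
  qed
  have m: "M $ k $ k = of_real (Re (M $ k $ k))" "Re (M $ k $ k) \<ge> 0"
    using psd_diag[OF insert.prems(1), of k] by (auto simp: nonneg_Reals_iff_complex complex_eq_iff)
  have N_entry: "N $ i $ j = M $ i $ j - c $ i * cnj (c $ j) / of_real (Re (M $ k $ k))" for i j
    unfolding N_def vector_minus_component scaleR_entry by (simp add: outer_def)
  have "N $ i $ i = 0" if "i \<notin> F" for i
  proof (cases "i = k")
    case True
    show ?thesis
    proof (cases "M $ k $ k = 0")
      case False
      have "c $ k = M $ k $ k"
        using False by (simp add: c_def matrix_vector_mult_def axis_def if_distrib cong: if_cong)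
      then show ?thesis using False
        using m(1) unfolding True N_entry
        by (metis complex_cnj_complex_of_real diff_self nonzero_mult_div_cancel_left)
    qed (simp add: True N_def c_def outer_def)
  next
    case False
    \<comment> \<open>As this entry of \<open>M\<close> is zero, the subtraction can only make it
      nonpositive, while positivity of \<open>N\<close> makes it nonnegative.\<close>
    then have "M $ i $ i = 0" using insert.prems that by simp
    then have e: "N $ i $ i = - of_real ((cmod (c $ i))\<^sup>2 / Re (M $ k $ k))"
      unfolding N_entry by (simp only: of_real_divide complex_norm_square diff_0)
    have "N $ i $ i \<in> \<real>\<^sub>\<ge>\<^sub>0" by (rule psd_diag[OF N])
    then have "(cmod (c $ i))\<^sup>2 / Re (M $ k $ k) \<le> 0"
      unfolding e nonneg_Reals_iff_complex by simp
    moreover have "(cmod (c $ i))\<^sup>2 / Re (M $ k $ k) \<ge> 0" using m by simp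
    ultimately show ?thesis using e by simp
  qed
  from insert.IH[OF N this] obtain v where v: "N = (\<Sum>i\<in>F. outer (v i) (v i))" by auto
  define w where "w = v(k := sqrt (1 / Re (M $ k $ k)) *\<^sub>R c)"
  have "outer (w k) (w k) = (1 / Re (M $ k $ k)) *\<^sub>R outer c c"
  proof -
    have "complex_of_real (sqrt r) * a * cnj (of_real (sqrt r) * b) = of_real r * (a * cnj b)"
      if "r \<ge> 0" for r a b
    proof -
      have "complex_of_real (sqrt r) * of_real (sqrt r) = of_real r"
        using that by (simp flip: of_real_mult)
      then have "complex_of_real (sqrt r) * of_real (sqrt r) * (a * cnj b) = of_real r * (a * cnj b)"
        by (rule arg_cong)
      then show ?thesis by (simp only: complex_cnj_mult complex_cnj_complex_of_real mult_ac)
    qed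
    from this[of "1 / Re (M $ k $ k)"] m(2) show ?thesis
      unfolding vec_eq_iff scaleR_entry
      by (simp only: w_def fun_upd_same outer_def vec_lambda_beta scaleR_vec_nth) simp
  qed
  moreover have "(\<Sum>i\<in>F. outer (w i) (w i)) = N"
    unfolding v using insert.hyps by (intro sum.cong) (auto simp: w_def)
  ultimately have "M = (\<Sum>i\<in>insert k F. outer (w i) (w i))"
    using insert.hyps by (simp add: N_def)
  then show ?case by blast
qed

lemma psd_sum_outer:
  fixes M :: "'s::finite op"
  assumes "psd M"
  obtains v :: "'s \<Rightarrow> complex ^ 's" where "M = (\<Sum>i\<in>UNIV. outer (v i) (v i))"
proof -
  have "\<exists>v :: 's \<Rightarrow> complex ^ 's. M = (\<Sum>i\<in>UNIV. outer (v i) (v i))"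
    by (rule psd_sum_outer_aux) (use assms in simp_all)
  then show thesis using that by blast
qed

text \<open>The conjugated vectors of a rank-one decomposition serve as the rows of
  \<open>V\<close>, so \<open>V\<close> need not be the positive root.\<close>

lemma psd_factor:
  fixes M :: "'s::finite op"
  assumes "psd M"
  obtains V :: "'s op" where "M = adj V ** V"
proof -
  obtain v :: "'s \<Rightarrow> complex ^ 's" where v: "M = (\<Sum>i\<in>UNIV. outer (v i) (v i))"
    using assms by (rule psd_sum_outer)
  define V :: "'s op" where "V = (\<chi> i j. cnj (v i $ j))"
  have "M $ i $ j = (adj V ** V) $ i $ j" for i j
    unfolding v sum_component by (simp add: V_def adj_def matrix_matrix_mult_def outer_def)
  then have "M = adj V ** V"
    unfolding vec_eq_iff by (intro allI)
  then show ?thesis by (rule that)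
qed

lemma trace_mult: "trace (M ** N) = (\<Sum>i\<in>UNIV. \<Sum>j\<in>UNIV. M $ i $ j * N $ j $ i)"
  by (simp add: trace_def matrix_matrix_mult_def)

lemma trace_mult_outer: "trace (M ** outer v v) = cip v (M *v v)"
  unfolding cip_matrix trace_mult by (simp add: outer_def mult_ac)

lemma matrix_mult_sum_right: "A ** sum f S = (\<Sum>x\<in>S. A ** f x)"
  for A :: "'s::finite op"
  by (induction S rule: infinite_finite_induct) (auto simp: matrix_add_ldistrib)

lemma trace_sum: "trace (sum f S) = (\<Sum>x\<in>S. trace (f x))"
  for f :: "_ \<Rightarrow> 's::finite op"
  by (induction S rule: infinite_finite_induct) (simp_all add: trace_add trace_def sum.distrib)

text \<open>Splitting \<open>B\<close> into rank-one terms turns the trace into a sum of values of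
  the form of \<open>A\<close>.\<close>

lemma trace_psd_mult_nonneg:
  fixes A B :: "'s::finite op"
  assumes "psd A" "psd B"
  shows "0 \<le> Re (trace (A ** B))"
proof -
  obtain v :: "'s \<Rightarrow> complex ^ 's" where v: "B = (\<Sum>i\<in>UNIV. outer (v i) (v i))"
    using assms(2) by (rule psd_sum_outer)
  show ?thesis using assms(1)
    by (auto simp: v matrix_mult_sum_right trace_sum trace_mult_outer psd_iff intro!: sum_nonneg)
qed

section \<open>Choi operators, pulled-back measurements and weak duality\<close>

definition choi :: "('n::finite op \<Rightarrow> 'm::finite op) \<Rightarrow> ('n \<times> 'm) op" where
  "choi \<Phi> = (\<chi> p q. \<Phi> (outer (axis (fst p) 1) (axis (fst q) 1)) $ snd p $ snd q)"

text \<open>\<open>pull d \<eta> P\<close> is \<open>(E\<^sup>* \<otimes> I) P (E \<otimes> I)\<close>, where \<open>E\<close> sends \<open>|a\<rangle>\<close> to the vector of \<open>C\<^sup>d\<close> with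
  components \<open>\<eta> i $ a\<close>.\<close>

definition pull :: "nat \<Rightarrow> (nat \<Rightarrow> complex ^ 'n) \<Rightarrow> 'm::finite bop \<Rightarrow> ('n::finite \<times> 'm) op" where
  "pull d \<eta> P = (\<chi> p q. \<Sum>i<d. \<Sum>j<d. cnj (\<eta> i $ fst p) * P i j $ snd p $ snd q * \<eta> j $ fst q)"

lemma sum_UNIV_pair: "(\<Sum>p\<in>UNIV. f p) = (\<Sum>a\<in>UNIV. \<Sum>b\<in>UNIV. f (a, b))"
  for f :: "'a::finite \<times> 'b::finite \<Rightarrow> 'c::comm_monoid_add"
  by (simp add: sum.cartesian_product)

lemma sum_sum_reindex_bij_betw:
  assumes "bij_betw e A B"
  shows "(\<Sum>i\<in>A. \<Sum>j\<in>A. f (e i) (e j)) = (\<Sum>a\<in>B. \<Sum>a'\<in>B. f a a')"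
  by (simp add: sum.reindex_bij_betw[OF assms, of "f _"]
      sum.reindex_bij_betw[OF assms, of "\<lambda>a. \<Sum>a'\<in>B. f a a'"])

lemma matrix_eq_sum_units:
  fixes X :: "'n::finite op"
  shows "X = (\<Sum>a\<in>UNIV. \<Sum>a'\<in>UNIV. map_matrix ((*) (X $ a $ a')) (outer (axis a 1) (axis a' 1)))"
proof -
  have "(\<Sum>a\<in>UNIV. \<Sum>a'\<in>UNIV. map_matrix ((*) (X $ a $ a')) (outer (axis a 1) (axis a' 1))) $ i $ j
      = (\<Sum>a\<in>UNIV. \<Sum>a'\<in>UNIV. if a' = j then if a = i then X $ i $ j else 0 else 0)" for i j
    unfolding sum_component
    by (intro sum.cong refl) (auto simp: map_matrix_def outer_def axis_def)
  then show ?thesis by (simp add: vec_eq_iff)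
qed

lemma clinear_map_0: "clinear_map \<Phi> \<Longrightarrow> \<Phi> 0 = 0"
  unfolding clinear_map_def by (metis add_cancel_right_right)

lemma clinear_map_sum:
  assumes "clinear_map \<Phi>"
  shows "\<Phi> (sum f S) = (\<Sum>x\<in>S. \<Phi> (f x))"
  using assms clinear_map_0[OF assms]
  by (induction S rule: infinite_finite_induct) (auto simp: clinear_map_def)

text \<open>By linearity \<open>\<Phi>\<close> is determined by its values on matrix units, which
  are the blocks of \<open>choi \<Phi>\<close>.\<close>

lemma clinear_map_choi:
  assumes "clinear_map \<Phi>"
  shows "\<Phi> X $ b $ b' = (\<Sum>a\<in>UNIV. \<Sum>a'\<in>UNIV. X $ a $ a' * choi \<Phi> $ (a, b) $ (a', b'))"
proof -
  have "\<Phi> X = (\<Sum>a\<in>UNIV. \<Sum>a'\<in>UNIV. map_matrix ((*) (X $ a $ a')) (\<Phi> (outer (axis a 1) (axis a' 1))))"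
    using assms by (subst matrix_eq_sum_units) (simp add: clinear_map_sum clinear_map_def)
  then show ?thesis by (simp add: choi_def map_matrix_def)
qed

text \<open>Moves the state from the argument of the map to the measurement; both sides are the same
  sixfold sum in different order. The guessing probability thus becomes linear in the operators
  \<open>pull d \<eta> (P x)\<close>.\<close>

lemma btrace_mult_eq_trace_choi_pull:
  fixes \<Phi> :: "'n::finite op \<Rightarrow> 'm::finite op"
  assumes "clinear_map \<Phi>"
  shows "btrace_mult d P (tensor_bid \<Phi> (bouter \<eta> \<eta>)) = trace (choi \<Phi> ** pull d \<eta> P)"
proof -
  have "btrace_mult d P (tensor_bid \<Phi> (bouter \<eta> \<eta>)) =
      (\<Sum>(i,j,b,b',a,a')\<in>{..<d}\<times>{..<d}\<times>UNIV\<times>UNIV\<times>UNIV\<times>UNIV.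
         P i j $ b $ b' * (\<eta> j $ a * cnj (\<eta> i $ a') * choi \<Phi> $ (a, b') $ (a', b)))"
    by (simp add: btrace_mult_def trace_mult tensor_bid_def bouter_def clinear_map_choi[OF assms]
        outer_def sum_distrib_left sum.cartesian_product[symmetric] del: UNIV_Times_UNIV)
  also have "\<dots> = (\<Sum>(a,b',a',b,i,j)\<in>UNIV\<times>UNIV\<times>UNIV\<times>UNIV\<times>{..<d}\<times>{..<d}.
         choi \<Phi> $ (a, b') $ (a', b) * (cnj (\<eta> i $ a') * P i j $ b $ b' * \<eta> j $ a))"
    by (rule sum.reindex_bij_witness[of _ "\<lambda>(a,b',a',b,i,j). (i,j,b,b',a,a')"
          "\<lambda>(i,j,b,b',a,a'). (a,b',a',b,i,j)"]) (auto simp: mult_ac)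
  also have "\<dots> = trace (choi \<Phi> ** pull d \<eta> P)"
    by (simp add: trace_mult pull_def sum_UNIV_pair sum_distrib_left sum.cartesian_product[symmetric]
         del: UNIV_Times_UNIV)
  finally show ?thesis .
qed

text \<open>A congruence: the form of \<open>pull d \<eta> P\<close> at \<open>v\<close> is the form
  of \<open>P\<close> at \<open>w = (E \<otimes> I) v\<close>.\<close>

lemma psd_pull:
  fixes P :: "'m::finite bop" and \<eta> :: "nat \<Rightarrow> complex ^ 'n::finite"
  assumes "bpsd d P"
  shows "psd (pull d \<eta> P)"
proof -
  have "cip v (pull d \<eta> P *v v) = (\<Sum>i<d. \<Sum>j<d. cip (w i) (P i j *v w j))"
    if w: "w = (\<lambda>j. \<chi> b. \<Sum>a\<in>UNIV. \<eta> j $ a * v $ (a, b))" for v w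
  proof -
    have "cip v (pull d \<eta> P *v v) = (\<Sum>(a,b,a',b',i,j)\<in>UNIV\<times>UNIV\<times>UNIV\<times>UNIV\<times>{..<d}\<times>{..<d}.
        cnj (v $ (a, b)) * (cnj (\<eta> i $ a) * P i j $ b $ b' * \<eta> j $ a') * v $ (a', b'))"
      by (simp add: cip_matrix pull_def sum_UNIV_pair sum_distrib_left sum_distrib_right
          sum.cartesian_product[symmetric] del: UNIV_Times_UNIV)
    also have "\<dots> = (\<Sum>(i,j,b,b',a',a)\<in>{..<d}\<times>{..<d}\<times>UNIV\<times>UNIV\<times>UNIV\<times>UNIV.
        cnj (\<eta> i $ a) * cnj (v $ (a, b)) * P i j $ b $ b' * (\<eta> j $ a' * v $ (a', b')))"
      by (rule sum.reindex_bij_witness[of _ "\<lambda>(i,j,b,b',a',a). (a,b,a',b',i,j)"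
          "\<lambda>(a,b,a',b',i,j). (i,j,b,b',a',a)"]) (auto simp: mult_ac)
    also have "\<dots> = (\<Sum>i<d. \<Sum>j<d. cip (w i) (P i j *v w j))"
      by (simp add: w cip_matrix sum_distrib_left sum_distrib_right sum.cartesian_product[symmetric]
          del: UNIV_Times_UNIV)
    finally show ?thesis .
  qed
  then show ?thesis using assms by (simp add: psd_def bpsd_def)
qed

text \<open>Completeness of the POVM collapses the double sum over ancilla indices to
  \<open>i = j\<close>. What remains on the input is \<open>E\<^sup>* E\<close>, the operator
  \<open>\<sigma>\<close> of the semidefinite program.\<close>

lemma sum_pull:
  fixes P :: "'x::finite \<Rightarrow> 'm::finite bop" and \<eta> :: "nat \<Rightarrow> complex ^ 'n::finite"
  assumes "bPOVM d P"
  shows "(\<Sum>x\<in>UNIV. pull d \<eta> (P x)) = kron (\<chi> a a'. \<Sum>i<d. cnj (\<eta> i $ a) * \<eta> i $ a') (mat 1)"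
proof -
  have "(\<Sum>x\<in>UNIV. pull d \<eta> (P x)) $ p $ q
      = kron (\<chi> a a'. \<Sum>i<d. cnj (\<eta> i $ a) * \<eta> i $ a') (mat 1) $ p $ q" for p q
  proof -
    have *: "(\<Sum>x\<in>UNIV. P x i j $ b $ b') = (if i = j \<and> b = b' then 1 else 0)"
      if "i < d" "j < d" for i j b b'
    proof -
      have "(\<Sum>x\<in>UNIV. P x i j) = (if i = j then mat 1 else 0)"
        using assms that by (simp add: bPOVM_def)
      then have "(\<Sum>x\<in>UNIV. P x i j) $ b $ b' = (if i = j then mat 1 else 0) $ b $ b'" by simp
      then show ?thesis by (simp add: mat_def)
    qed
    have "(\<Sum>x\<in>UNIV. pull d \<eta> (P x)) $ p $ q
        = (\<Sum>i<d. \<Sum>j<d. \<Sum>x\<in>UNIV. cnj (\<eta> i $ fst p) * P x i j $ snd p $ snd q * \<eta> j $ fst q)"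
      unfolding sum_component pull_def vec_lambda_beta
      by (subst sum.swap) (simp add: sum.swap[of _ UNIV])
    also have "\<dots> = (\<Sum>i<d. \<Sum>j<d. cnj (\<eta> i $ fst p) * (\<Sum>x\<in>UNIV. P x i j $ snd p $ snd q) * \<eta> j $ fst q)"
      by (simp add: sum_distrib_left sum_distrib_right)
    also have "\<dots> = (\<Sum>i<d. \<Sum>j<d. if j = i then (if snd p = snd q then cnj (\<eta> i $ fst p) * \<eta> i $ fst q else 0) else 0)"
      by (intro sum.cong refl) (auto simp: *)
    also have "\<dots> = (\<Sum>i<d. if snd p = snd q then cnj (\<eta> i $ fst p) * \<eta> i $ fst q else 0)"
      by (intro sum.cong refl) simp
    finally show ?thesis by (simp add: kron_def mat_def)
  qed
  then show ?thesis by (simp only: vec_eq_iff) simp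
qed

text \<open>Tensoring with the identity and the partial trace are adjoint for the trace pairing.
  This is how the primal constraint \<open>\<Sum>\<^sub>x Q\<^sub>x = \<sigma> \<otimes> I\<close>
  leads to a dual condition on \<open>ptrace_snd \<gamma>\<close>.\<close>

lemma trace_mult_kron_mat1:
  "trace (M ** kron T (mat 1)) = trace (ptrace_snd M ** T)"
proof -
  have "trace (M ** kron T (mat 1))
      = (\<Sum>a\<in>UNIV. \<Sum>b\<in>UNIV. \<Sum>a'\<in>UNIV. M $ (a, b) $ (a', b) * T $ a' $ a)"
    by (simp add: trace_mult sum_UNIV_pair kron_def mat_def if_distrib[of "\<lambda>x. _ * x"] cong: if_cong)
  also have "\<dots> = trace (ptrace_snd M ** T)"
    unfolding trace_mult ptrace_snd_def
    by (simp add: sum_distrib_right) (rule sum.cong[OF refl sum.swap])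
  finally show ?thesis .
qed

text \<open>With \<open>Q\<^sub>x = pull d \<eta> (P x)\<close>, positivity of
  \<open>\<gamma> - J\<^sub>x\<close> and of \<open>Q\<^sub>x\<close> gives \<open>\<Sum>\<^sub>x tr
  (J\<^sub>x Q\<^sub>x) \<le> tr (\<gamma> (\<sigma> \<otimes> I)) = l tr \<sigma> = l\<close>. The
  ancilla dimension \<open>d\<close> is arbitrary, so no larger ancilla beats a dual feasible
  point.\<close>

lemma weak_duality:
  fixes W :: "'x::finite \<Rightarrow> 'n::finite op \<Rightarrow> 'm::finite op"
  assumes P: "bPOVM d P" and \<eta>: "bunit_vector d \<eta>"
    and W: "\<And>x. clinear_map (W x)" and \<gamma>: "\<And>x. op_ge \<gamma> (choi (W x))" and pt: "ptrace_snd \<gamma> = l *\<^sub>R mat 1"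
  shows "Re (\<Sum>x\<in>UNIV. btrace_mult d (P x) (tensor_bid (W x) (bouter \<eta> \<eta>))) \<le> l"
proof -
  \<comment> \<open>\<open>tr \<sigma> = 1\<close> for the operator \<open>\<sigma>\<close> of
    \<open>sum_pull\<close>.\<close>
  have "(\<Sum>a\<in>UNIV. \<Sum>i<d. cnj (\<eta> i $ a) * \<eta> i $ a) = (\<Sum>i<d. cip (\<eta> i) (\<eta> i))"
    by (subst sum.swap) (simp add: cip_def)
  also have "\<dots> = of_real (\<Sum>i<d. (norm (\<eta> i))\<^sup>2)" by (simp add: cip_self)
  also have "\<dots> = 1" using \<eta> by (simp add: bunit_vector_def)
  finally have 1: "(\<Sum>a\<in>UNIV. \<Sum>i<d. cnj (\<eta> i $ a) * \<eta> i $ a) = 1" .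
  have "0 \<le> Re (trace ((\<gamma> - choi (W x)) ** pull d \<eta> (P x)))" for x
    using \<gamma> P by (intro trace_psd_mult_nonneg psd_pull) (auto simp: op_ge_def bPOVM_def)
  then have *: "Re (trace (choi (W x) ** pull d \<eta> (P x))) \<le> Re (trace (\<gamma> ** pull d \<eta> (P x)))" for x
    by (simp add: trace_mult algebra_simps sum_subtractf)
  have "Re (\<Sum>x\<in>UNIV. btrace_mult d (P x) (tensor_bid (W x) (bouter \<eta> \<eta>)))
     \<le> (\<Sum>x\<in>UNIV. Re (trace (\<gamma> ** pull d \<eta> (P x))))"
    by (simp add: btrace_mult_eq_trace_choi_pull[OF W] sum_mono *)
  also have "\<dots> = Re (trace (\<gamma> ** (\<Sum>x\<in>UNIV. pull d \<eta> (P x))))"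
    by (simp add: matrix_mult_sum_right trace_sum)
  also have "\<dots> = Re (\<Sum>a\<in>UNIV. \<Sum>a'\<in>UNIV. (if a = a' then of_real l * (\<Sum>i<d. cnj (\<eta> i $ a) * \<eta> i $ a) else 0))"
    unfolding sum_pull[OF P] unfolding trace_mult_kron_mat1 pt unfolding trace_mult scaleR_entry
    by (intro arg_cong[of _ _ Re] sum.cong refl) (auto simp: mat_def)
  also have "\<dots> = Re (of_real l * (\<Sum>a\<in>UNIV. \<Sum>i<d. cnj (\<eta> i $ a) * \<eta> i $ a))"
    by (simp add: sum_distrib_left)
  also have "\<dots> = l" unfolding 1 by simp
  finally show ?thesis .
qed

text \<open>Complete positivity is applied to the unnormalised maximally entangled operator
  \<open>X\<close>, with an ancilla of the dimension of the input. The blocks of \<open>X\<close>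
  are the matrix units, so its image is \<open>choi \<Phi>\<close> in block form.\<close>

lemma psd_choi:
  fixes \<Phi> :: "'n::finite op \<Rightarrow> 'm::finite op"
  assumes "completely_positive \<Phi>"
  shows "psd (choi \<Phi>)"
proof -
  define d where "d = CARD('n)"
  obtain e :: "nat \<Rightarrow> 'n" where e: "bij_betw e {..<d} UNIV"
    using ex_bij_betw_nat_finite[of "UNIV :: 'n set"] by (auto simp: d_def atLeast0LessThan)
  define X :: "'n bop" where "X = (\<lambda>i j. outer (axis (e i) 1) (axis (e j) 1))"
  have c: "cip v (axis a 1) = cnj (v $ a)" "cip (axis a 1) v = v $ a" for v :: "complex ^ 'n" and a
    by (simp_all add: cip_def axis_def if_distrib[of "\<lambda>x. _ * x"] if_distrib[of "\<lambda>x. x * _"] if_distrib[of cnj] cong: if_cong)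
  have "(\<Sum>i<d. \<Sum>j<d. cip (v i) (X i j *v v j)) = of_real ((cmod (\<Sum>i<d. v i $ e i))\<^sup>2)" for v
    unfolding complex_norm_square
    by (subst sum.swap) (simp add: X_def cip_outer c sum_product mult.commute)
  then have "bpsd d X" by (simp add: bpsd_def nonneg_Reals_iff_complex)
  then have b: "bpsd d (tensor_bid \<Phi> X)" using assms by (simp add: completely_positive_def)
  have "cip v (choi \<Phi> *v v) = (\<Sum>i<d. \<Sum>j<d. cip (u i) (tensor_bid \<Phi> X i j *v u j))"
    if u: "u = (\<lambda>i. \<chi> b. v $ (e i, b))" for u v
  proof -
    have "(\<Sum>i<d. \<Sum>j<d. cip (u i) (tensor_bid \<Phi> X i j *v u j))
      = (\<Sum>i<d. \<Sum>j<d. cip (\<chi> b. v $ (e i, b)) (\<Phi> (outer (axis (e i) 1) (axis (e j) 1)) *v (\<chi> b. v $ (e j, b))))"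
      by (simp add: u tensor_bid_def X_def)
    also have "\<dots> = (\<Sum>a\<in>UNIV. \<Sum>a'\<in>UNIV. cip (\<chi> b. v $ (a, b)) (\<Phi> (outer (axis a 1) (axis a' 1)) *v (\<chi> b. v $ (a', b))))"
      by (rule sum_sum_reindex_bij_betw[OF e])
    also have "\<dots> = cip v (choi \<Phi> *v v)"
      unfolding cip_matrix by (simp add: sum_UNIV_pair choi_def) (rule sum.cong[OF refl sum.swap])
    finally show ?thesis by simp
  qed
  then show ?thesis using b by (simp add: psd_def bpsd_def)
qed

section \<open>Kronecker products, operator bounds and closedness of the positive cone\<close>

lemma trace_scaleR: "trace (r *\<^sub>R M) = of_real r * trace M"
  for M :: "'s::finite op"
  by (simp only: trace_def scaleR_entry sum_distrib_left)

lemma scaleR_matrix_mult_right: "M ** (r *\<^sub>R N) = r *\<^sub>R (M ** N)"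
  for M N :: "'s::finite op"
  unfolding vec_eq_iff scaleR_entry
  by (simp_all only: matrix_matrix_mult_def vec_lambda_beta scaleR_entry sum_distrib_left mult_ac simp_thms)

lemma kron_mult: "kron A B ** kron C D = kron (A ** C) (B ** D)"
  by (simp add: vec_eq_iff kron_def matrix_matrix_mult_def sum_UNIV_pair sum_product mult_ac)

lemma adj_kron: "adj (kron A B) = kron (adj A) (adj B)"
  by (simp add: vec_eq_iff kron_def adj_def)

lemma kron_mat1: "kron (mat 1) (mat 1) = mat 1"
  by (auto simp: vec_eq_iff kron_def mat_def prod_eq_iff)

lemma kron_add_left: "kron (A + B) C = kron A C + kron B C"
  by (simp add: vec_eq_iff kron_def algebra_simps)

lemma kron_scaleR_left: "kron (r *\<^sub>R A) C = r *\<^sub>R kron A C"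
  unfolding vec_eq_iff scaleR_entry by (simp add: kron_def scaleR_entry del: vector_scaleR_component)

lemma psd_gram: "psd (adj V ** V)"
  for V :: "'s::finite op"
  using psd_congruence[OF psd_mat1, of V] by simp

lemma psd_kron_mat1:
  fixes M :: "'s::finite op"
  assumes "psd M"
  shows "psd (kron M (mat 1 :: 't::finite op))"
proof -
  obtain V :: "'s op" where V: "M = adj V ** V" using assms by (rule psd_factor)
  have "kron M (mat 1 :: 't op) = adj (kron V (mat 1)) ** kron V (mat 1)"
    by (simp add: V adj_kron kron_mult)
  then show ?thesis by (simp only: psd_gram)
qed

lemma inner_op: "inner G M = Re (trace (adj G ** M))"
proof -
  have "inner G M = (\<Sum>j\<in>UNIV. \<Sum>i\<in>UNIV. Re (cnj (G $ j $ i) * M $ j $ i))"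
    by (simp add: inner_vec_def inner_complex_def)
  then show ?thesis
    by (subst (asm) sum.swap) (simp add: trace_mult adj_def)
qed

lemma norm_op_squared: "(norm V)\<^sup>2 = Re (trace (adj V ** V))"
  for V :: "'s::finite op"
  by (simp add: inner_op[symmetric] power2_norm_eq_inner)

text \<open>The sum \<open>s\<close> of the moduli of all entries bounds the form of
  \<open>G\<close> relative to \<open>(norm v)\<^sup>2\<close>. The shift \<open>s + 1\<close> stays
  strictly positive even for \<open>G = 0\<close>.\<close>

lemma psd_shift:
  fixes G :: "'s::finite op"
  assumes "hermitian G"
  obtains r where "r > 0" "psd (r *\<^sub>R mat 1 + G)"
proof -
  define s where "s = (\<Sum>i\<in>UNIV. \<Sum>j\<in>UNIV. cmod (G $ i $ j))"
  have "\<bar>Re (cip v (G *v v))\<bar> \<le> s * (norm v)\<^sup>2" for v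
  proof -
    have "\<bar>Re (cip v (G *v v))\<bar> \<le> cmod (\<Sum>i\<in>UNIV. \<Sum>j\<in>UNIV. cnj (v $ i) * G $ i $ j * v $ j)"
      unfolding cip_matrix by (rule abs_Re_le_cmod)
    also have "\<dots> \<le> (\<Sum>i\<in>UNIV. \<Sum>j\<in>UNIV. cmod (cnj (v $ i) * G $ i $ j * v $ j))"
      by (intro order_trans[OF norm_sum] sum_mono order_refl)
    also have "\<dots> \<le> (\<Sum>i\<in>UNIV. \<Sum>j\<in>UNIV. cmod (G $ i $ j) * (norm v)\<^sup>2)"
    proof (intro sum_mono)
      fix i j
      have "cmod (v $ i) * cmod (v $ j) \<le> norm v * norm v"
        by (intro mult_mono component_le_norm_cart) (auto simp: Finite_Cartesian_Product.norm_nth_le)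
      then have "cmod (G $ i $ j) * (cmod (v $ i) * cmod (v $ j)) \<le> cmod (G $ i $ j) * (norm v * norm v)"
        by (intro mult_left_mono) auto
      then show "cmod (cnj (v $ i) * G $ i $ j * v $ j) \<le> cmod (G $ i $ j) * (norm v)\<^sup>2"
        by (simp add: norm_mult mult_ac power2_eq_square)
    qed
    also have "\<dots> = s * (norm v)\<^sup>2" by (simp add: s_def sum_distrib_right)
    finally show ?thesis .
  qed
  note s = this
  have s0: "s \<ge> 0" by (auto simp: s_def intro!: sum_nonneg)
  have "0 \<le> Re (cip v (((s + 1) *\<^sub>R mat 1 + G) *v v))" for v
  proof -
    have "Re (cip v (((s + 1) *\<^sub>R mat 1 + G) *v v)) = (s + 1) * (norm v)\<^sup>2 + Re (cip v (G *v v))"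
      by (simp only: cip_matrix_add cip_matrix_scaleR matrix_vector_mul_lid cip_self plus_complex.simps Re_complex_of_real flip: of_real_mult)
    then show ?thesis using s[of v] by (simp add: algebra_simps abs_le_iff) (smt (verit) zero_le_power2)
  qed
  moreover have "hermitian ((s + 1) *\<^sub>R mat 1 + G)"
    using assms unfolding hermitian_def vec_eq_iff vector_add_component scaleR_entry
    by (simp add: mat_def)
  ultimately have "psd ((s + 1) *\<^sub>R mat 1 + G)" by (simp add: psd_iff)
  then show ?thesis using that[of "s + 1"] s0 by simp
qed

lemma closed_psd: "closed {M :: 's::finite op. psd M}"
proof -
  have "{M :: 's op. psd M} = (\<Inter>v. (\<lambda>M. cip v (M *v v)) -` \<real>\<^sub>\<ge>\<^sub>0)" by (auto simp: psd_def)
  moreover have "closed ((\<lambda>M :: 's op. cip v (M *v v)) -` \<real>\<^sub>\<ge>\<^sub>0)" for v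
    unfolding cip_matrix
    by (intro continuous_closed_vimage closed_nonneg_Reals_complex) (auto intro!: continuous_intros)
  ultimately show ?thesis by auto
qed

text \<open>The complement \<open>N\<close> caps the diagonal of \<open>M\<close> at 1, and
  \<open>psd_entry_bound\<close> then caps every entry. This makes the set of POVMs bounded.\<close>

lemma psd_le_one_norm_le:
  fixes M N :: "'s::finite op"
  assumes "psd M" "psd N" "M + N = mat 1"
  shows "norm M \<le> real CARD('s) * real CARD('s)"
proof -
  have d: "Re (M $ i $ i) \<le> 1" for i
  proof -
    have "M $ i $ i + N $ i $ i = 1" using assms(3) by (simp add: vec_eq_iff mat_def)
    moreover have "0 \<le> Re (N $ i $ i)" using psd_diag[OF assms(2)] by (simp add: nonneg_Reals_iff_complex)
    ultimately show ?thesis by (simp add: complex_eq_iff)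
  qed
  have e: "cmod (M $ i $ j) \<le> 1" for i j
    using psd_entry_bound[OF assms(1), of i j] d[of i] d[of j] by linarith
  have n: "norm v \<le> (\<Sum>i\<in>UNIV. norm (v $ i))" for v :: "'b::real_normed_vector ^ 's"
    by (simp add: norm_vec_def L2_set_le_sum)
  have "norm M \<le> (\<Sum>i\<in>UNIV. \<Sum>j\<in>UNIV. cmod (M $ i $ j))"
    by (intro order_trans[OF n] sum_mono n)
  also have "\<dots> \<le> (\<Sum>i\<in>(UNIV :: 's set). \<Sum>j\<in>(UNIV :: 's set). 1)"
    by (intro sum_mono e)
  finally show ?thesis by simp
qed

section \<open>Existence of an optimal measurement and state for an ancilla isomorphic to the
  input\<close>

definition POVM :: "('x::finite \<Rightarrow> 's::finite op) \<Rightarrow> bool" where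
  "POVM P \<longleftrightarrow> (\<forall>x. psd (P x)) \<and> (\<Sum>x\<in>UNIV. P x) = mat 1"

text \<open>The primal objective when the ancilla is a copy of the input \<open>'n\<close>. The
  state is given by its coefficient matrix, with rows indexed by the ancilla, so
  \<open>norm \<eta>\<close> is the norm of the state vector; the conjugation by
  \<open>kron \<eta> (mat 1)\<close> corresponds to \<open>pull\<close>.\<close>

definition guess_value :: "('x::finite \<Rightarrow> ('n::finite \<times> 'm::finite) op) \<Rightarrow> ('x \<Rightarrow> ('n \<times> 'm) op) \<Rightarrow> 'n op \<Rightarrow> real" where
  "guess_value J P \<eta> =
     Re (\<Sum>x\<in>UNIV. trace (J x ** (adj (kron \<eta> (mat 1)) ** P x ** kron \<eta> (mat 1))))"

text \<open>A continuous function attains its maximum on the product of the compact set of POVMs and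
  the unit sphere of states.\<close>

lemma guess_value_max:
  fixes J :: "'x::finite \<Rightarrow> ('n::finite \<times> 'm::finite) op"
  obtains P \<eta> where "POVM P" "norm \<eta> = 1"
    "\<And>P' \<eta>'. POVM P' \<Longrightarrow> norm \<eta>' = 1 \<Longrightarrow> guess_value J P' \<eta>' \<le> guess_value J P \<eta>"
proof -
  \<comment> \<open>Families are stored as vectors indexed by \<open>'x\<close>, a Euclidean space
    in which closed and bounded sets are compact.\<close>
  define A :: "(('n \<times> 'm) op ^ 'x) set" where "A = {P. POVM (($) P)}"
  have "closed A"
  proof -
    have "A = (\<Inter>x. (\<lambda>P. P $ x) -` {M. psd M}) \<inter> (\<lambda>P. \<Sum>x\<in>UNIV. P $ x) -` {mat 1}"
      by (auto simp: A_def POVM_def)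
    moreover have "closed ((\<lambda>P :: ('n \<times> 'm) op ^ 'x. P $ x) -` {M. psd M})" for x
      by (intro continuous_closed_vimage closed_psd) (auto intro!: continuous_intros)
    moreover have "closed ((\<lambda>P :: ('n \<times> 'm) op ^ 'x. \<Sum>x\<in>UNIV. P $ x) -` {mat 1})"
      by (intro continuous_closed_vimage) (auto intro!: continuous_intros)
    ultimately show ?thesis by auto
  qed
  moreover have "bounded A"
  proof -
    define c where "c = real CARD('n \<times> 'm) * real CARD('n \<times> 'm)"
    have "norm P \<le> real CARD('x) * c" if "P \<in> A" for P
    proof -
      have "norm (P $ x) \<le> c" for x
      proof -
        have "P $ x + (\<Sum>y\<in>UNIV - {x}. P $ y) = mat 1"
          using that by (simp add: A_def POVM_def sum.remove[symmetric])
        then show ?thesis unfolding c_def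
          using that by (intro psd_le_one_norm_le[OF _ psd_sum]) (auto simp: A_def POVM_def)
      qed
      moreover have "norm P \<le> (\<Sum>x\<in>UNIV. norm (P $ x))"
        by (simp add: norm_vec_def[of P] L2_set_le_sum)
      ultimately show ?thesis by (meson order_trans sum_bounded_above)
    qed
    then show ?thesis by (auto simp: bounded_iff)
  qed
  ultimately have "compact (A \<times> sphere (0 :: 'n op) 1)"
    by (intro compact_Times compact_sphere) (simp add: compact_eq_bounded_closed)
  moreover have "A \<times> sphere (0 :: 'n op) 1 \<noteq> {}"
  proof -
    have "(\<chi> x. (1 / CARD('x)) *\<^sub>R mat 1) \<in> A"
      by (auto simp: A_def POVM_def psd_scaleR psd_mat1 sum_constant_scaleR simp del: sum_constant)
    moreover have "sphere (0 :: 'n op) 1 \<noteq> {}" by simp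
    ultimately show ?thesis by blast
  qed
  moreover have "continuous_on (A \<times> sphere 0 1) (\<lambda>(P, \<eta>). guess_value J (($) P) \<eta>)"
    unfolding guess_value_def trace_def matrix_matrix_mult_def adj_def kron_def case_prod_unfold
    by (auto intro!: continuous_intros)
  ultimately have "\<exists>z\<in>A \<times> sphere 0 1. \<forall>w\<in>A \<times> sphere 0 1.
      (case w of (P, \<eta>) \<Rightarrow> guess_value J (($) P) \<eta>) \<le> (case z of (P, \<eta>) \<Rightarrow> guess_value J (($) P) \<eta>)"
    by (rule continuous_attains_sup)
  then obtain z where z: "z \<in> A \<times> sphere 0 1"
    "\<forall>w\<in>A \<times> sphere 0 1. (case w of (P, \<eta>) \<Rightarrow> guess_value J (($) P) \<eta>) \<le> (case z of (P, \<eta>) \<Rightarrow> guess_value J (($) P) \<eta>)"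
    by (elim bexE)
  obtain P \<eta> where P: "z = (P, \<eta>)" by (cases z)
  show ?thesis
  proof (rule that[of "($) P" \<eta>])
    show "POVM (($) P)" "norm \<eta> = 1" using z(1) by (auto simp: P A_def)
    fix P' :: "'x \<Rightarrow> ('n \<times> 'm) op" and \<eta>' :: "'n op" assume "POVM P'" "norm \<eta>' = 1"
    moreover have "($) (vec_lambda P') = P'" by (rule ext) simp
    ultimately have "(vec_lambda P', \<eta>') \<in> A \<times> sphere 0 1" by (simp add: A_def)
    from bspec[OF z(2) this] show "guess_value J P' \<eta>' \<le> guess_value J (($) P) \<eta>"
      by (simp add: P guess_value_def)
  qed
qed

text \<open>Passage to the numbered ancillas of \<open>P_guess_given\<close>: a bijection
  \<open>e\<close> from \<open>{..<d}\<close> with \<open>d = CARD('n)\<close> relabels the ancilla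
  basis.\<close>

lemma bop_of_op:
  fixes P :: "'x::finite \<Rightarrow> ('n::finite \<times> 'm::finite) op"
  assumes P: "POVM P" and \<eta>: "norm \<eta> = 1"
  obtains d P' \<eta>' where "bPOVM d P'" "bunit_vector d \<eta>'"
    "\<And>x. pull d \<eta>' (P' x) = adj (kron \<eta> (mat 1)) ** P x ** kron \<eta> (mat 1)"
proof -
  define d where "d = CARD('n)"
  obtain e :: "nat \<Rightarrow> 'n" where e: "bij_betw e {..<d} UNIV"
    using ex_bij_betw_nat_finite[of "UNIV :: 'n set"] by (auto simp: d_def atLeast0LessThan)
  have e_sum: "(\<Sum>i<d. f (e i)) = (\<Sum>a\<in>UNIV. f a)" for f :: "'n \<Rightarrow> 'c::comm_monoid_add"
    by (rule sum.reindex_bij_betw[OF e])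
  define P' :: "'x \<Rightarrow> 'm bop" where "P' = (\<lambda>x i j. \<chi> b b'. P x $ (e i, b) $ (e j, b'))"
  define \<eta>' where "\<eta>' = (\<lambda>i. \<eta> $ e i)"
  have "bpsd d (P' x)" for x
  proof -
    have "(\<Sum>i<d. \<Sum>j<d. cip (v i) (P' x i j *v v j)) \<in> \<real>\<^sub>\<ge>\<^sub>0" for v
    proof -
      \<comment> \<open>Glues the components \<open>v i\<close> with \<open>i < d\<close> into one
        vector; \<open>inv_into\<close> recovers the number of a basis label.\<close>
      define w where "w = (\<chi> p. v (inv_into {..<d} e (fst p)) $ snd p)"
      have w: "w $ (e i, b) = v i $ b" if "i < d" for i b
        using that e by (simp add: w_def bij_betw_def)
      have "(\<Sum>i<d. \<Sum>j<d. cip (v i) (P' x i j *v v j))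
          = (\<Sum>i<d. \<Sum>j<d. \<Sum>b\<in>UNIV. \<Sum>b'\<in>UNIV. cnj (w $ (e i, b)) * P x $ (e i, b) $ (e j, b') * w $ (e j, b'))"
        by (intro sum.cong refl) (simp add: cip_matrix P'_def w)
      also have "\<dots> = (\<Sum>a\<in>UNIV. \<Sum>a'\<in>UNIV. \<Sum>b\<in>UNIV. \<Sum>b'\<in>UNIV. cnj (w $ (a, b)) * P x $ (a, b) $ (a', b') * w $ (a', b'))"
        by (rule sum_sum_reindex_bij_betw[OF e])
      also have "\<dots> = cip w (P x *v w)"
        unfolding cip_matrix sum_UNIV_pair by (rule sum.cong[OF refl sum.swap])
      finally show ?thesis using P by (simp add: POVM_def psd_def)
    qed
    then show ?thesis by (simp add: bpsd_def)
  qed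
  moreover have "(\<Sum>x\<in>UNIV. P' x i j) = (if i = j then mat 1 else 0)" if "i < d" "j < d" for i j
  proof -
    have ij: "e i = e j \<longleftrightarrow> i = j" using e that by (auto simp: bij_betw_def inj_on_def)
    have "(\<Sum>x\<in>UNIV. P' x i j) $ b $ b' = (\<Sum>x\<in>UNIV. P x) $ (e i, b) $ (e j, b')" for b b'
      unfolding sum_component by (simp add: P'_def)
    moreover have "(\<Sum>x\<in>UNIV. P x) = mat 1" using P by (simp add: POVM_def)
    ultimately have "(\<Sum>x\<in>UNIV. P' x i j) $ b $ b' = mat 1 $ (e i, b) $ (e j, b')" for b b'
      by simp
    then have "(\<Sum>x\<in>UNIV. P' x i j) $ b $ b' = (if i = j then mat 1 else 0) $ b $ b'" for b b'
      by (simp add: mat_def ij)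
    then show ?thesis by (simp only: vec_eq_iff) simp
  qed
  ultimately have "bPOVM d P'" by (simp add: bPOVM_def)
  moreover have "bunit_vector d \<eta>'"
  proof -
    have "(\<Sum>i<d. (norm (\<eta>' i))\<^sup>2) = (\<Sum>a\<in>UNIV. (norm (\<eta> $ a))\<^sup>2)"
      unfolding \<eta>'_def by (rule e_sum)
    also have "\<dots> = (norm \<eta>)\<^sup>2" by (simp add: norm_vec_def[of \<eta>] L2_set_def sum_nonneg)
    finally show ?thesis using \<eta> by (simp add: bunit_vector_def)
  qed
  moreover have "pull d \<eta>' (P' x) = adj (kron \<eta> (mat 1)) ** P x ** kron \<eta> (mat 1)" for x
  proof -
    have "pull d \<eta>' (P' x) $ p $ q = (adj (kron \<eta> (mat 1)) ** P x ** kron \<eta> (mat 1)) $ p $ q" for p q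
    proof -
      have "pull d \<eta>' (P' x) $ p $ q = (\<Sum>a\<in>UNIV. \<Sum>a'\<in>UNIV. cnj (\<eta> $ a $ fst p) * P x $ (a, snd p) $ (a', snd q) * \<eta> $ a' $ fst q)"
        unfolding pull_def P'_def \<eta>'_def vec_lambda_beta by (rule sum_sum_reindex_bij_betw[OF e])
      also have "\<dots> = (adj (kron \<eta> (mat 1)) ** P x ** kron \<eta> (mat 1)) $ p $ q"
        by (subst sum.swap)
          (simp add: matrix_matrix_mult_def adj_def kron_def mat_def sum_UNIV_pair if_distrib[of "\<lambda>x. _ * x"] if_distrib[of cnj]
            if_distrib[of "\<lambda>x. x * _"] sum_distrib_right cong: if_cong)
      finally show ?thesis .
    qed
    then show ?thesis by (simp only: vec_eq_iff) simp
  qed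
  ultimately show ?thesis by (rule that)
qed

section \<open>Recovering a measurement and a state from a feasible family\<close>

lemma trace_mat1: "trace (mat 1 :: 's::finite op) = of_nat CARD('s)"
  by (simp add: trace_def mat_def)

lemma trace_max_mixed: "trace (max_mixed :: 's::finite op) = 1"
  by (simp only: max_mixed_def trace_scaleR trace_mat1) simp

lemma psd_max_mixed: "psd (max_mixed :: 's::finite op)"
  by (simp add: max_mixed_def psd_scaleR psd_mat1)

text \<open>Definiteness makes \<open>V\<close> in \<open>\<sigma> = V\<^sup>* V\<close> invertible.
  Conjugating \<open>Q x\<close> by the inverse of \<open>V \<otimes> I\<close> yields a POVM, and
  \<open>V\<close> itself is the state: its squared norm is \<open>tr \<sigma> = 1\<close>.
  Conjugating back returns \<open>Q x\<close>.\<close>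

lemma guess_bound_definite:
  fixes J Q :: "'x::finite \<Rightarrow> ('n::finite \<times> 'm::finite) op" and \<sigma> :: "'n op"
  assumes bound: "\<And>P \<eta>. POVM P \<Longrightarrow> norm \<eta> = 1 \<Longrightarrow> guess_value J P \<eta> \<le> p"
    and Q: "\<And>x. psd (Q x)" "(\<Sum>x\<in>UNIV. Q x) = kron \<sigma> (mat 1)"
    and \<sigma>: "psd \<sigma>" "trace \<sigma> = 1" "\<And>v. cip v (\<sigma> *v v) = 0 \<Longrightarrow> v = 0"
  shows "Re (\<Sum>x\<in>UNIV. trace (J x ** Q x)) \<le> p"
proof -
  obtain V :: "'n op" where V: "\<sigma> = adj V ** V" using \<sigma>(1) by (rule psd_factor)
  have "v = 0" if "V *v v = 0" for v
    using \<sigma>(3)[of v] that by (simp add: V matrix_vector_mul_assoc[symmetric] cip_def)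
  then have "\<exists>B. B ** V = mat 1"
    unfolding matrix_left_invertible_ker by blast
  then obtain B where B: "B ** V = mat 1" "V ** B = mat 1"
    using matrix_left_right_inverse by blast
  define E where "E = kron V (mat 1 :: 'm op)"
  define F where "F = kron B (mat 1 :: 'm op)"
  have EF: "E ** F = mat 1" "F ** E = mat 1" by (simp_all add: E_def F_def kron_mult B kron_mat1)
  define P where "P = (\<lambda>x. adj F ** Q x ** F)"
  have "(\<Sum>x\<in>UNIV. P x) = adj F ** (\<Sum>x\<in>UNIV. Q x) ** F"
  proof -
    have "sum f S ** A = (\<Sum>x\<in>S. f x ** A)" for f :: "'x \<Rightarrow> ('n \<times> 'm) op" and S and A :: "('n \<times> 'm) op"
      by (induction S rule: infinite_finite_induct) (auto simp: vec_eq_iff matrix_matrix_mult_def distrib_right sum.distrib)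
    then show ?thesis by (simp add: P_def matrix_mult_sum_right)
  qed
  also have "(\<Sum>x\<in>UNIV. Q x) = adj E ** E" by (simp add: Q(2) V E_def adj_kron kron_mult)
  also have "adj F ** (adj E ** E) ** F = adj (E ** F) ** (E ** F)"
    by (simp add: adj_mult matrix_mul_assoc)
  finally have "POVM P" using Q(1) by (simp add: POVM_def EF) (simp add: P_def psd_congruence)
  moreover have "norm V = 1"
    using norm_op_squared[of V] \<sigma>(2) by (simp add: V[symmetric] power2_eq_1_iff) (smt (verit) norm_ge_zero)
  ultimately have "guess_value J P V \<le> p" by (rule bound)
  moreover have "adj E ** P x ** E = Q x" for x
  proof -
    have "adj E ** P x ** E = adj (F ** E) ** Q x ** (F ** E)"
      by (simp add: P_def adj_mult matrix_mul_assoc)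
    then show ?thesis by (simp add: EF)
  qed
  ultimately show ?thesis by (simp add: guess_value_def E_def)
qed

text \<open>A singular \<open>\<sigma>\<close> is reached by mixing with the maximally mixed state, for which
  \<open>guess_bound_definite\<close> applies.\<close>

lemma guess_bound:
  fixes J Q :: "'x::finite \<Rightarrow> ('n::finite \<times> 'm::finite) op" and \<sigma> :: "'n op"
  assumes bound: "\<And>P \<eta>. POVM P \<Longrightarrow> norm \<eta> = 1 \<Longrightarrow> guess_value J P \<eta> \<le> p"
    and Q: "\<And>x. psd (Q x)" "(\<Sum>x\<in>UNIV. Q x) = kron \<sigma> (mat 1)"
    and \<sigma>: "psd \<sigma>" "trace \<sigma> = 1"
  shows "Re (\<Sum>x\<in>UNIV. trace (J x ** Q x)) \<le> p"
proof -
  define R :: "('n \<times> 'm) op" where "R = (1 / real CARD('x)) *\<^sub>R kron max_mixed (mat 1)"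
  define v where "v = Re (\<Sum>x\<in>UNIV. trace (J x ** Q x))"
  define c where "c = Re (\<Sum>x\<in>UNIV. trace (J x ** R))"
  \<comment> \<open>For \<open>e > 0\<close> the mixed marginal is definite, so the bound holds on
    the segment from \<open>Q\<close> to the constant family \<open>R\<close>, except possibly at
    \<open>Q\<close>; the value there is affine in \<open>e\<close>.\<close>
  have *: "(1 - e) * v + e * c \<le> p" if e: "0 < e" "e \<le> 1" for e
  proof -
    have "Re (\<Sum>x\<in>UNIV. trace (J x ** ((1 - e) *\<^sub>R Q x + e *\<^sub>R R))) \<le> p"
    proof (rule guess_bound_definite[OF bound, where \<sigma> = "(1 - e) *\<^sub>R \<sigma> + e *\<^sub>R max_mixed"])
      show "psd ((1 - e) *\<^sub>R Q x + e *\<^sub>R R)" for x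
        using e Q(1) by (auto simp: R_def intro!: psd_add psd_scaleR psd_kron_mat1 psd_max_mixed)
      have "(\<Sum>x\<in>(UNIV :: 'x set). R) = kron max_mixed (mat 1)"
        by (simp add: R_def sum_constant_scaleR del: sum_constant)
      then show "(\<Sum>x\<in>UNIV. (1 - e) *\<^sub>R Q x + e *\<^sub>R R) = kron ((1 - e) *\<^sub>R \<sigma> + e *\<^sub>R max_mixed) (mat 1)"
        by (simp only: sum.distrib scaleR_sum_right[symmetric] Q(2) kron_add_left kron_scaleR_left)
      show "psd ((1 - e) *\<^sub>R \<sigma> + e *\<^sub>R max_mixed)"
        using e \<sigma> by (auto intro!: psd_add psd_scaleR psd_max_mixed)
      show "trace ((1 - e) *\<^sub>R \<sigma> + e *\<^sub>R max_mixed) = 1"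
        by (simp only: trace_add trace_scaleR \<sigma> trace_max_mixed) simp
      fix u assume "cip u (((1 - e) *\<^sub>R \<sigma> + e *\<^sub>R max_mixed) *v u) = 0"
      then have "(1 - e) * Re (cip u (\<sigma> *v u)) + e * (1 / CARD('n) * (norm u)\<^sup>2) = 0"
        by (simp only: max_mixed_def cip_matrix_add cip_matrix_scaleR matrix_vector_mul_lid cip_self
            complex_eq_iff flip: of_real_mult) simp
      moreover have "(1 - e) * Re (cip u (\<sigma> *v u)) \<ge> 0" using e \<sigma>(1) by (simp add: psd_iff)
      moreover have "e * (1 / CARD('n) * (norm u)\<^sup>2) \<ge> 0" using e by simp
      ultimately have "e * (1 / CARD('n) * (norm u)\<^sup>2) = 0" by linarith
      then show "u = 0" using e by simp
    qed
    also have "Re (\<Sum>x\<in>UNIV. trace (J x ** ((1 - e) *\<^sub>R Q x + e *\<^sub>R R))) = (1 - e) * v + e * c"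
      by (simp only: matrix_add_ldistrib scaleR_matrix_mult_right trace_add trace_scaleR sum.distrib
          sum_distrib_left[symmetric] v_def c_def) simp
    finally show ?thesis .
  qed
  show ?thesis
  proof (rule ccontr)
    assume "\<not> ?thesis"
    then have vp: "v > p" by (simp add: v_def)
    moreover have cp: "c \<le> p" using *[of 1] by simp
    \<comment> \<open>At this \<open>e\<close> the mixed value is the midpoint of \<open>v\<close>
      and \<open>p\<close>, still above \<open>p\<close>.\<close>
    define e where "e = (v - p) / (2 * (v - c))"
    have "0 < e" "e \<le> 1" using vp cp by (auto simp: e_def field_simps)
    then have "(1 - e) * v + e * c \<le> p" by (rule *)
    then have "v - e * (v - c) \<le> p" by (simp add: algebra_simps)
    moreover have "e * (v - c) = (v - p) / 2" using vp cp unfolding e_def by (simp add: divide_simps)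
    ultimately have "v - (v - p) / 2 \<le> p" by simp
    then show False using vp by (simp add: field_simps)
  qed
qed

section \<open>Strong duality by a separating hyperplane\<close>

text \<open>Extracts sign conditions from the hyperplane: a functional bounded above on a ray cannot
  grow along it. The chosen \<open>r\<close> would overshoot \<open>b\<close> by at least 1.\<close>

lemma affine_bounded_imp_slope_nonpos:
  fixes c m b :: real
  assumes "\<And>r. r \<ge> 0 \<Longrightarrow> c + r * m \<le> b"
  shows "m \<le> 0"
proof (rule ccontr)
  assume "\<not> m \<le> 0"
  then have "c + ((\<bar>b - c\<bar> + 1) / m) * m \<le> b" by (intro assms) simp
  then show False using \<open>\<not> m \<le> 0\<close> by simp
qed

lemma ptrace_snd_add: "ptrace_snd (M + N) = ptrace_snd M + ptrace_snd N"
  by (simp add: ptrace_snd_def vec_eq_iff sum.distrib)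

lemma ptrace_snd_scaleR: "ptrace_snd (r *\<^sub>R M) = r *\<^sub>R ptrace_snd M"
  unfolding vec_eq_iff scaleR_entry
  by (simp only: ptrace_snd_def vec_lambda_beta scaleR_entry sum_distrib_left simp_thms)

lemma ptrace_snd_kron_mat1: "ptrace_snd (kron M (mat 1 :: 'm::finite op)) = real CARD('m) *\<^sub>R M"
  unfolding vec_eq_iff scaleR_entry by (simp add: ptrace_snd_def kron_def mat_def)

lemma hermitian_add: "hermitian M \<Longrightarrow> hermitian N \<Longrightarrow> hermitian (M + N)"
  and hermitian_diff: "hermitian M \<Longrightarrow> hermitian N \<Longrightarrow> hermitian (M - N)"
  and hermitian_ptrace_snd: "hermitian K \<Longrightarrow> hermitian (ptrace_snd K)"
  by (simp_all add: hermitian_def vec_eq_iff ptrace_snd_def)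

lemma hermitian_scaleR: "hermitian M \<Longrightarrow> hermitian (r *\<^sub>R M)"
  unfolding hermitian_def vec_eq_iff scaleR_entry by (simp add: scaleR_entry del: vector_scaleR_component)

text \<open>The convex set \<open>S\<close> of pairs (constraint residual, value) misses the open
  ray \<open>T\<close> of values above \<open>p\<close> at residual zero. A separating functional
  \<open>(G, t)\<close> has \<open>t > 0\<close>, and \<open>- G / t\<close> is a multiplier that
  satisfies the dual constraints up to a partial trace at most \<open>p I\<close>, which is then
  raised to equality.\<close>

lemma strong_duality:
  fixes J :: "'x::finite \<Rightarrow> ('n::finite \<times> 'm::finite) op"
  assumes J: "\<And>x. hermitian (J x)"
    and bound: "\<And>P \<eta>. POVM P \<Longrightarrow> norm \<eta> = 1 \<Longrightarrow> guess_value J P \<eta> \<le> p"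
  shows "\<exists>\<gamma>. hermitian \<gamma> \<and> (\<forall>x. op_ge \<gamma> (J x)) \<and> ptrace_snd \<gamma> = p *\<^sub>R mat 1"
proof -
  \<comment> \<open>The anti-Hermitian slack \<open>K\<close> forces the separating functional on the space of all operators
    to be Hermitian.\<close>
  define feas where "feas = (\<lambda>(Q :: 'x \<Rightarrow> ('n \<times> 'm) op, \<sigma> :: 'n op, K :: ('n \<times> 'm) op).
      (\<forall>x. psd (Q x)) \<and> psd \<sigma> \<and> trace \<sigma> = 1 \<and> adj K = - K)"
  define img where "img = (\<lambda>(Q :: 'x \<Rightarrow> ('n \<times> 'm) op, \<sigma> :: 'n op, K :: ('n \<times> 'm) op).
      ((\<Sum>x\<in>UNIV. Q x) - kron \<sigma> (mat 1) + K, Re (\<Sum>x\<in>UNIV. trace (J x ** Q x))))"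
  define S where "S = img ` Collect feas"
  define T where "T = {(0 :: ('n \<times> 'm) op)} \<times> {p<..}"
  have "convex S"
  proof (rule convexI)
    fix a b and u v :: real assume "a \<in> S" "b \<in> S" and uv: "0 \<le> u" "0 \<le> v" "u + v = 1"
    then obtain Q1 \<sigma>1 K1 Q2 \<sigma>2 K2 where 1: "a = img (Q1, \<sigma>1, K1)" "feas (Q1, \<sigma>1, K1)"
      and 2: "b = img (Q2, \<sigma>2, K2)" "feas (Q2, \<sigma>2, K2)" by (auto simp: S_def)
    have "feas (\<lambda>x. u *\<^sub>R Q1 x + v *\<^sub>R Q2 x, u *\<^sub>R \<sigma>1 + v *\<^sub>R \<sigma>2, u *\<^sub>R K1 + v *\<^sub>R K2)"
    proof -
      have "complex_of_real u + of_real v = 1" using uv by (simp flip: of_real_add)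
      then have "trace (u *\<^sub>R \<sigma>1 + v *\<^sub>R \<sigma>2) = 1"
        using 1 2 by (simp only: feas_def trace_add trace_scaleR case_prod_conv) simp
      moreover have "adj (u *\<^sub>R K1 + v *\<^sub>R K2) = - (u *\<^sub>R K1 + v *\<^sub>R K2)"
      proof -
        have "adj (u *\<^sub>R K1 + v *\<^sub>R K2) = u *\<^sub>R adj K1 + v *\<^sub>R adj K2"
          unfolding vec_eq_iff vector_add_component scaleR_entry
          by (simp add: adj_def scaleR_entry del: vector_scaleR_component)
        then show ?thesis using 1 2 by (simp add: feas_def)
      qed
      ultimately show ?thesis using 1 2 uv by (simp add: feas_def psd_add psd_scaleR)
    qed
    moreover have "u *\<^sub>R a + v *\<^sub>R b = img (\<lambda>x. u *\<^sub>R Q1 x + v *\<^sub>R Q2 x, u *\<^sub>R \<sigma>1 + v *\<^sub>R \<sigma>2, u *\<^sub>R K1 + v *\<^sub>R K2)"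
    proof -
      have "Re (\<Sum>x\<in>UNIV. trace (J x ** (u *\<^sub>R Q1 x + v *\<^sub>R Q2 x)))
         = u * Re (\<Sum>x\<in>UNIV. trace (J x ** Q1 x)) + v * Re (\<Sum>x\<in>UNIV. trace (J x ** Q2 x))"
        by (simp only: matrix_add_ldistrib scaleR_matrix_mult_right trace_add trace_scaleR sum.distrib
          sum_distrib_left[symmetric]) simp
      then show ?thesis unfolding 1 2 img_def
        by (simp add: sum.distrib scaleR_sum_right kron_add_left kron_scaleR_left scaleR_add_right scaleR_diff_right)
    qed
    ultimately show "u *\<^sub>R a + v *\<^sub>R b \<in> S" by (auto simp: S_def)
  qed
  moreover have "convex T" unfolding T_def by (intro convex_Times) auto
  moreover have "S \<inter> T = {}"
  proof (rule ccontr)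
    assume "S \<inter> T \<noteq> {}"
    then obtain Q \<sigma> K where f: "feas (Q, \<sigma>, K)" and i: "img (Q, \<sigma>, K) \<in> T" by (auto simp: S_def)
    have *: "(\<Sum>x\<in>UNIV. Q x) - kron \<sigma> (mat 1) + K = 0" using i by (simp add: T_def img_def)
    \<comment> \<open>At residual zero \<open>K\<close> is both Hermitian and anti-Hermitian, hence
      zero. The constraint then holds exactly, and \<open>guess_bound\<close> excludes a value above
      \<open>p\<close>.\<close>
    have "hermitian ((\<Sum>x\<in>UNIV. Q x) - kron \<sigma> (mat 1))"
      using f by (intro hermitian_diff psd_hermitian psd_sum psd_kron_mat1) (auto simp: feas_def)
    moreover have "(\<Sum>x\<in>UNIV. Q x) - kron \<sigma> (mat 1) = - K" using * by (simp add: add_eq_0_iff)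
    ultimately have "adj (- K) = - K" by (simp add: hermitian_iff_adj)
    moreover have "adj (- K) = - adj K" by (simp add: adj_def vec_eq_iff)
    ultimately have "K = - K" using f by (simp add: feas_def)
    then have "K = 0" by (simp add: vec_eq_iff)
    then have "(\<Sum>x\<in>UNIV. Q x) = kron \<sigma> (mat 1)" using * by simp
    then have "Re (\<Sum>x\<in>UNIV. trace (J x ** Q x)) \<le> p"
      using f by (intro guess_bound[OF bound]) (auto simp: feas_def)
    then show False using i by (simp add: T_def img_def)
  qed
  moreover have f0: "feas (\<lambda>_. 0, max_mixed, 0)"
    by (simp add: feas_def psd_0 psd_max_mixed trace_max_mixed) (simp add: adj_def vec_eq_iff)
  then have "S \<noteq> {}" by (auto simp: S_def)
  moreover have "(0, p + 1) \<in> T" by (simp add: T_def)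
  then have "T \<noteq> {}" by blast
  ultimately have "\<exists>a b. a \<noteq> 0 \<and> (\<forall>z\<in>S. inner a z \<le> b) \<and> (\<forall>z\<in>T. inner a z \<ge> b)"
    by (intro separating_hyperplane_sets)
  then obtain a b where a: "a \<noteq> 0" "\<forall>z\<in>S. inner a z \<le> b" "\<forall>z\<in>T. b \<le> inner a z"
    by (elim exE conjE)
  obtain G t where Gt: "a = (G, t)" by (cases a)
  have S: "inner G ((\<Sum>x\<in>UNIV. Q x) - kron \<sigma> (mat 1) + K) + t * Re (\<Sum>x\<in>UNIV. trace (J x ** Q x)) \<le> b"
    if "feas (Q, \<sigma>, K)" for Q \<sigma> K
  proof -
    have "img (Q, \<sigma>, K) \<in> S" using that by (auto simp: S_def)
    then have "inner a (img (Q, \<sigma>, K)) \<le> b" using a by blast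
    then show ?thesis by (simp add: img_def Gt)
  qed
  have T: "b \<le> t * s" if "s > p" for s
  proof -
    have "(0, s) \<in> T" using that by (simp add: T_def)
    then have "b \<le> inner a (0, s)" using a by blast
    then show ?thesis by (simp add: Gt)
  qed
  \<comment> \<open>\<open>T\<close> contains arbitrarily large values, on which a negative
    \<open>t\<close> would break the lower bound \<open>b\<close>.\<close>
  have t0: "t \<ge> 0"
  proof -
    have "- t * (p + 1) + r * (- t) \<le> - b" if "r \<ge> 0" for r
      using T[of "p + 1 + r"] that by (simp add: algebra_simps)
    then show ?thesis using affine_bounded_imp_slope_nonpos[of "- t * (p + 1)" "- t" "- b"] by simp
  qed
  \<comment> \<open>The values in \<open>T\<close> come arbitrarily close to \<open>p\<close>; the
    denominator \<open>t + 1\<close> also covers \<open>t = 0\<close>.\<close>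
  have bp: "b \<le> t * p"
  proof (rule field_le_epsilon)
    fix e :: real assume "e > 0"
    have "b \<le> t * (p + e / (t + 1))" using \<open>e > 0\<close> t0 by (intro T) simp
    also have "\<dots> \<le> t * p + e" using \<open>e > 0\<close> t0 by (simp add: field_simps)
    finally show "b \<le> t * p + e" .
  qed
  \<comment> \<open>The slack ranges over a real subspace, so both signs of \<open>r\<close> are
    available and a bounded functional must vanish on it.\<close>
  have inner_K: "inner G K = 0" if "adj K = - K" for K
  proof -
    have "inner G (- kron max_mixed (mat 1)) + r * inner G K \<le> b" for r
    proof -
      have "adj (r *\<^sub>R K) = - (r *\<^sub>R K)"
      proof -
        have "adj (r *\<^sub>R K) = r *\<^sub>R adj K"
          unfolding vec_eq_iff scaleR_entry by (simp add: adj_def scaleR_entry del: vector_scaleR_component)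
        then show ?thesis using that by simp
      qed
      then have "feas (\<lambda>_. 0, max_mixed, r *\<^sub>R K)" using f0 by (simp add: feas_def)
      from S[OF this] show ?thesis by (simp add: inner_diff_right inner_add_right trace_def)
    qed
    note * = this
    have "inner G K \<le> 0" using * by (rule affine_bounded_imp_slope_nonpos)
    moreover have "- inner G K \<le> 0"
      using *[of "- r" for r]
      by (intro affine_bounded_imp_slope_nonpos[of "inner G (- kron max_mixed (mat 1))" _ b]) simp
    ultimately show ?thesis by simp
  qed
  have G: "hermitian G"
  proof -
    \<comment> \<open>Twice the anti-Hermitian part of \<open>G\<close>. Both
      \<open>inner G K\<close> and \<open>inner (adj G) K\<close> vanish, so \<open>K\<close> is
      orthogonal to itself.\<close>
    define K where "K = G - adj G"
    have K: "adj K = - K" by (simp add: K_def adj_def vec_eq_iff)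
    have "inner (adj A) (adj B) = inner A B" for A B :: "('n \<times> 'm) op"
      unfolding inner_op adj_adj trace_mult by (subst sum.swap) (simp add: adj_def mult.commute)
    from this[of G "adj K"] have "inner (adj G) K = inner G (adj K)" by simp
    moreover have "inner K K = inner G K - inner (adj G) K" by (simp add: K_def inner_diff_left)
    ultimately have "inner K K = 0" using inner_K[OF K] K by simp
    then have "G - adj G = 0" by (simp add: K_def)
    then have "G = adj G" by (rule right_minus_eq[THEN iffD1])
    then show ?thesis unfolding hermitian_iff_adj by (rule sym)
  qed
  \<comment> \<open>Slater's condition: the constraint map covers a neighbourhood of 0 in the Hermitian operators.\<close>
  have "t \<noteq> 0"
  proof
    assume t: "t = 0"
    obtain r where r: "r > 0" "psd (r *\<^sub>R mat 1 + G)" using psd_shift[OF G] .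
    \<comment> \<open>With \<open>c * r = 1 / CARD('n)\<close> the identity part cancels
      \<open>kron max_mixed (mat 1)\<close>, leaving the residual \<open>c *\<^sub>R G\<close>, on
      which the functional is positive unless \<open>G = 0\<close>.\<close>
    define c where "c = 1 / (real CARD('n) * r)"
    define x0 :: 'x where "x0 = undefined"
    define Q where "Q = (\<lambda>x. if x = x0 then c *\<^sub>R (r *\<^sub>R mat 1 + G) else 0)"
    have "feas (Q, max_mixed, 0)" using f0 r by (simp add: feas_def Q_def c_def psd_scaleR)
    moreover have "(\<Sum>x\<in>UNIV. Q x) - kron max_mixed (mat 1) = c *\<^sub>R G"
    proof -
      have "c * r = 1 / real CARD('n)" using r by (simp add: c_def)
      then show ?thesis
        by (simp add: Q_def max_mixed_def kron_scaleR_left kron_mat1 scaleR_add_right)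
    qed
    ultimately have "c * inner G G \<le> b" using S[of Q max_mixed 0] by (simp add: t)
    then have "c * inner G G \<le> 0" using bp t by simp
    moreover have "c > 0" using r by (simp add: c_def)
    ultimately have "inner G G \<le> 0" by (simp add: mult_le_0_iff)
    then have "G = 0" using inner_gt_zero_iff[of G] by linarith
    then show False using a(1) by (simp add: Gt t zero_prod_def)
  qed
  then have t: "t > 0" using t0 by simp
  define \<gamma> where "\<gamma> = - (1 / t) *\<^sub>R G"
  have \<gamma>: "hermitian \<gamma>" using G unfolding \<gamma>_def by (rule hermitian_scaleR)
  \<comment> \<open>The Lagrangian inequality: \<open>Q\<close> and \<open>\<sigma>\<close> are no
    longer coupled, so each dual constraint can be read off by varying one of them.\<close>
  have main: "Re (\<Sum>x\<in>UNIV. trace (J x ** Q x)) \<le> p + inner \<gamma> (\<Sum>x\<in>UNIV. Q x) - inner \<gamma> (kron \<sigma> (mat 1))"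
    if "\<And>x. psd (Q x)" "psd \<sigma>" "trace \<sigma> = 1" for Q \<sigma>
  proof -
    have "feas (Q, \<sigma>, 0)" using that f0 by (simp add: feas_def)
    from S[OF this] bp
    have "inner G ((\<Sum>x\<in>UNIV. Q x) - kron \<sigma> (mat 1)) + t * Re (\<Sum>x\<in>UNIV. trace (J x ** Q x)) \<le> t * p"
      by simp
    then show ?thesis using t by (simp add: \<gamma>_def inner_diff_right field_simps)
  qed
  have ge: "psd (\<gamma> - J x0)" for x0
  proof -
    \<comment> \<open>Test families: an unbounded multiple of a rank-one operator at the single
      outcome \<open>x0\<close>.\<close>
    have "Re (cip v ((J x0) *v v)) - Re (cip v (\<gamma> *v v)) \<le> 0" for v
    proof (rule affine_bounded_imp_slope_nonpos)
      fix r :: real assume r: "r \<ge> 0"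
      define Q where "Q = (\<lambda>x. if x = x0 then r *\<^sub>R outer v v else 0)"
      have s: "(\<Sum>x\<in>UNIV. Q x) = r *\<^sub>R outer v v" by (simp add: Q_def)
      have "(\<Sum>x\<in>UNIV. trace (J x ** Q x)) = (\<Sum>x\<in>UNIV. if x = x0 then trace (J x0 ** (r *\<^sub>R outer v v)) else 0)"
        by (intro sum.cong refl) (simp add: Q_def trace_def)
      then have j: "(\<Sum>x\<in>UNIV. trace (J x ** Q x)) = of_real r * cip v (J x0 *v v)"
        by (simp only: scaleR_matrix_mult_right trace_scaleR trace_mult_outer sum.delta finite UNIV_I if_True)
      have "inner \<gamma> (outer v v) = Re (cip v (\<gamma> *v v))"
        using \<gamma> by (simp add: inner_op hermitian_iff_adj trace_mult_outer)
      then show "(inner \<gamma> (kron max_mixed (mat 1)) - p) + r * (Re (cip v ((J x0) *v v)) - Re (cip v (\<gamma> *v v))) \<le> 0"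
        using main[of Q max_mixed] r unfolding s j
        by (simp add: Q_def psd_scaleR psd_outer psd_0 psd_max_mixed trace_max_mixed algebra_simps)
    qed
    then show ?thesis
      unfolding psd_iff cip_matrix_diff by (simp add: hermitian_diff \<gamma> J)
  qed
  \<comment> \<open>The deficit of the partial trace. It is positive by \<open>main\<close> with
    \<open>Q = 0\<close> and \<open>\<sigma>\<close> a pure state.\<close>
  define D where "D = p *\<^sub>R mat 1 - ptrace_snd \<gamma>"
  have D: "psd D"
  proof -
    have "0 \<le> Re (cip v (D *v v))" for v
    proof (cases "v = 0")
      case False
      define r where "r = 1 / (norm v)\<^sup>2"
      have r: "r > 0" using False by (simp add: r_def)
      have tr: "trace (r *\<^sub>R outer v v) = 1"
      proof -
        have "trace (outer v v) = cip v v" by (simp add: trace_def outer_def cip_def mult.commute)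
        then show ?thesis unfolding trace_scaleR cip_self using False by (simp add: r_def flip: of_real_power)
      qed
      have "inner \<gamma> (kron (r *\<^sub>R outer v v) (mat 1)) = r * Re (cip v (ptrace_snd \<gamma> *v v))"
        using \<gamma> unfolding inner_op hermitian_iff_adj trace_mult_kron_mat1 scaleR_matrix_mult_right trace_scaleR
        by (simp add: trace_mult_kron_mat1 scaleR_matrix_mult_right trace_scaleR trace_mult_outer)
      moreover have "inner \<gamma> (kron (r *\<^sub>R outer v v) (mat 1)) \<le> p"
        using main[of "\<lambda>_. 0" "r *\<^sub>R outer v v"] r tr by (simp add: psd_0 psd_scaleR psd_outer trace_def)
      ultimately have "r * Re (cip v (ptrace_snd \<gamma> *v v)) \<le> p" by simp
      then have "Re (cip v (ptrace_snd \<gamma> *v v)) \<le> p * (norm v)\<^sup>2"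
        using False by (simp add: r_def field_simps)
      then show ?thesis
        by (simp add: D_def cip_matrix_diff cip_matrix_scaleR cip_self del: of_real_power)
    qed (simp add: cip_def)
    moreover have "hermitian D" unfolding D_def
      by (intro hermitian_diff hermitian_scaleR hermitian_ptrace_snd \<gamma> psd_hermitian psd_mat1)
    ultimately show ?thesis by (simp add: psd_iff)
  qed
  \<comment> \<open>Spreading \<open>D\<close> uniformly over the output makes the partial trace
    exactly \<open>p I\<close>; the added term is positive, so the operator inequalities
    survive.\<close>
  define \<gamma>' where "\<gamma>' = \<gamma> + (1 / real CARD('m)) *\<^sub>R kron D (mat 1)"
  have pd: "psd ((1 / real CARD('m)) *\<^sub>R kron D (mat 1 :: 'm op))"
    by (intro psd_scaleR psd_kron_mat1 D) simp
  show ?thesis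
  proof (intro exI conjI allI)
    show "hermitian \<gamma>'" unfolding \<gamma>'_def by (intro hermitian_add \<gamma> psd_hermitian pd)
    have "\<gamma>' - J x = (\<gamma> - J x) + (1 / real CARD('m)) *\<^sub>R kron D (mat 1)" for x
      by (simp add: \<gamma>'_def)
    then show "op_ge \<gamma>' (J x)" for x unfolding op_ge_def by (metis psd_add ge pd)
    show "ptrace_snd \<gamma>' = p *\<^sub>R mat 1"
      by (simp add: \<gamma>'_def ptrace_snd_add ptrace_snd_scaleR ptrace_snd_kron_mat1 D_def)
  qed
qed

section \<open>The guessing probability for fixed \<open>y\<close> as the optimal value of the dual
  program\<close>

text \<open>The optimum \<open>p\<close> over ancillas isomorphic to the input is attained, and
  strong duality supplies a dual point of the same value. Weak duality against that point makes
  \<open>p\<close> the greatest value over all \<open>d\<close>; applied to the optimal measurement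
  and state, it also bounds every dual value from below.\<close>

lemma P_guess_given_dual:
  fixes W :: "'b1::finite \<Rightarrow> 'b0::finite \<Rightarrow> 'a0::finite op \<Rightarrow> 'a1::finite op"
  assumes cp: "\<And>x. completely_positive (W x y)"
  shows "\<exists>\<gamma>. hermitian \<gamma> \<and> (\<forall>x. op_ge \<gamma> (choi (W x y))) \<and> ptrace_snd \<gamma> = P_guess_given W y *\<^sub>R mat 1"
    and "\<lbrakk>\<And>x. op_ge \<gamma>' (choi (W x y)); ptrace_snd \<gamma>' = l *\<^sub>R mat 1\<rbrakk> \<Longrightarrow> P_guess_given W y \<le> l"
proof -
  have lin: "clinear_map (W x y)" for x using cp by (simp add: completely_positive_def)
  define J where "J = (\<lambda>x. choi (W x y))"
  obtain P \<eta> where P: "POVM P" "norm \<eta> = 1"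
    and max: "\<And>P' \<eta>'. POVM P' \<Longrightarrow> norm \<eta>' = 1 \<Longrightarrow> guess_value J P' \<eta>' \<le> guess_value J P \<eta>"
    using guess_value_max[of J] by blast
  define p where "p = guess_value J P \<eta>"
  have "hermitian (J x)" for x unfolding J_def by (intro psd_hermitian psd_choi cp)
  then have "\<exists>\<gamma>. hermitian \<gamma> \<and> (\<forall>x. op_ge \<gamma> (J x)) \<and> ptrace_snd \<gamma> = p *\<^sub>R mat 1"
    using max unfolding p_def by (rule strong_duality)
  then obtain \<gamma> where \<gamma>: "hermitian \<gamma>" "\<And>x. op_ge \<gamma> (J x)" "ptrace_snd \<gamma> = p *\<^sub>R mat 1"
    by blast
  obtain d P' \<eta>' where P': "bPOVM d P'" "bunit_vector d \<eta>'"
    "\<And>x. pull d \<eta>' (P' x) = adj (kron \<eta> (mat 1)) ** P x ** kron \<eta> (mat 1)"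
    using bop_of_op[OF P] by blast
  have p: "p = Re (\<Sum>x\<in>UNIV. btrace_mult d (P' x) (tensor_bid (W x y) (bouter \<eta>' \<eta>')))"
    by (simp only: p_def guess_value_def btrace_mult_eq_trace_choi_pull[OF lin] P'(3) J_def)
  have Pg: "P_guess_given W y = p"
    unfolding P_guess_given_def
  proof (rule Greatest_equality)
    show "\<exists>d P \<eta>. bPOVM d P \<and> bunit_vector d \<eta> \<and>
        p = Re (\<Sum>x\<in>UNIV. btrace_mult d (P x) (tensor_bid (W x y) (bouter \<eta> \<eta>)))"
      using P'(1,2) p by (intro exI conjI)
    show "q \<le> p" if "\<exists>d P \<eta>. bPOVM d P \<and> bunit_vector d \<eta> \<and>
        q = Re (\<Sum>x\<in>UNIV. btrace_mult d (P x) (tensor_bid (W x y) (bouter \<eta> \<eta>)))" for q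
      using that weak_duality[where W = "\<lambda>x. W x y", OF _ _ lin \<gamma>(2)[unfolded J_def] \<gamma>(3)] by auto
  qed
  show "\<exists>\<gamma>. hermitian \<gamma> \<and> (\<forall>x. op_ge \<gamma> (choi (W x y))) \<and> ptrace_snd \<gamma> = P_guess_given W y *\<^sub>R mat 1"
    using \<gamma> by (intro exI[of _ \<gamma>]) (simp add: Pg J_def)
  show "P_guess_given W y \<le> l" if "\<And>x. op_ge \<gamma>' (choi (W x y))" "ptrace_snd \<gamma>' = l *\<^sub>R mat 1"
    unfolding Pg p using P'(1,2) lin that by (rule weak_duality)
qed

section \<open>Block structure of the Choi state and the min-entropy program\<close>

lemma phi_plus_entry: "phi_plus $ (i, j) $ (k, l) = (if i = j \<and> k = l then 1 else 0)"
proof -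
  have "phi_plus $ (i, j) $ (k, l) = (\<Sum>a\<in>UNIV. \<Sum>b\<in>UNIV. if b = k then if a = i then if i = j \<and> k = l then 1 else 0 else 0 else 0)"
    unfolding phi_plus_def sum_component
    by (intro sum.cong refl) (auto simp: kron_def outer_def axis_def)
  then show ?thesis by simp
qed

text \<open>Classicality of \<open>B\<close> in block form: the matrix unit
  \<open>|y\<rangle>\<langle>y'|\<close> survives \<open>sandwich z\<close> only if
  \<open>y = y' = z\<close>, and the output register is diagonal in \<open>x\<close>.\<close>

lemma choi_state_entry:
  fixes \<Omega> :: "('a0::finite \<times> 'b0::finite) op \<Rightarrow> ('a1::finite \<times> 'b1::finite) op"
  assumes "B_classical \<Omega> W"
  shows "choi_state \<Omega> $ ((p, y), x) $ ((q, y'), x') =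
    (if y = y' \<and> x = x' then of_real (1 / (CARD('a0) * CARD('b0))) * choi (W x y) $ p $ q else 0)"
proof -
  obtain a b a' b' where pq: "p = (a, b)" "q = (a', b')" by (cases p, cases q)
  have W0: "W x y 0 = 0" for x y
    using assms by (intro clinear_map_0) (simp add: B_classical_def completely_positive_def)
  have 1: "(\<chi> i j. reindex (\<lambda>((a0, b0), (a0', b0')). ((a0, a0'), (b0, b0')))
           (kron (phi_plus :: ('a0 \<times> 'a0) op) (phi_plus :: ('b0 \<times> 'b0) op)) $ ((a, y), i) $ ((a', y'), j))
    = outer (axis (a, y) 1) (axis (a', y') 1)"
    by (auto simp: vec_eq_iff reindex_def kron_def phi_plus_entry outer_def axis_def)
  have 2: "sandwich z (outer (axis (a, y) 1) (axis (a', y') 1)) =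
     (if y = z \<and> y' = z then outer (axis a 1) (axis a' 1) else 0)" for z
    by (auto simp: sandwich_def outer_def axis_def vec_eq_iff)
  have "\<Omega> (outer (axis (a, y) 1) (axis (a', y') 1)) $ (b, x) $ (b', x')
     = (\<Sum>z\<in>UNIV. \<Sum>u\<in>UNIV. kron (W u z (if y = z \<and> y' = z then outer (axis a 1) (axis a' 1) else 0))
          (outer (axis u 1) (axis u 1)) $ (b, x) $ (b', x'))"
    using assms by (simp add: B_classical_def 2)
  also have "\<dots> = (\<Sum>z\<in>UNIV. \<Sum>u\<in>UNIV. if u = x then if z = y then if y = y' \<and> x = x' then choi (W x y) $ p $ q else 0 else 0 else 0)"
    by (intro sum.cong refl) (auto simp: kron_def W0 outer_def axis_def choi_def pq)
  also have "\<dots> = (if y = y' \<and> x = x' then choi (W x y) $ p $ q else 0)" by simp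
  finally show ?thesis
    unfolding choi_state_def scaleR_entry
    by (simp add: reindex_def[of "\<lambda>(((a0, a1), b0), b1). ((a0, b0), (a1, b1))"] id_tensor_def pq 1)
qed

text \<open>For injective \<open>f\<close> this is a principal submatrix up to relabelling: test
  vectors are extended by zero outside \<open>range f\<close>.\<close>

lemma psd_reindex:
  fixes f :: "'t::finite \<Rightarrow> 's::finite"
  assumes "psd M" "inj f"
  shows "psd (reindex f M)"
proof -
  have "cip v (reindex f M *v v) = cip w (M *v w)"
    if w: "w = (\<chi> q. if q \<in> range f then v $ inv f q else 0)" for v w
  proof -
    have "cip v (reindex f M *v v) = (\<Sum>p\<in>UNIV. \<Sum>q\<in>UNIV. cnj (w $ f p) * M $ f p $ f q * w $ f q)"
      unfolding cip_matrix by (simp add: w reindex_def inv_f_f[OF assms(2)])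
    also have "\<dots> = (\<Sum>p\<in>range f. \<Sum>q\<in>range f. cnj (w $ p) * M $ p $ q * w $ q)"
      using assms(2) by (intro sum_sum_reindex_bij_betw) (auto simp: bij_betw_def)
    also have "\<dots> = (\<Sum>p\<in>range f. \<Sum>q\<in>UNIV. cnj (w $ p) * M $ p $ q * w $ q)"
      by (intro sum.cong refl sum.mono_neutral_left) (auto simp: w)
    also have "\<dots> = cip w (M *v w)"
      unfolding cip_matrix by (intro sum.mono_neutral_left) (auto simp: w)
    finally show ?thesis .
  qed
  then show ?thesis using assms(1) by (simp add: psd_def)
qed

lemma trace_ptrace_snd: "trace (ptrace_snd M) = trace M"
  by (simp add: trace_def ptrace_snd_def sum_UNIV_pair)

lemma trace_psd_nonneg: "psd M \<Longrightarrow> 0 \<le> Re (trace M)"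
  using psd_diag[of M] by (auto simp: trace_def nonneg_Reals_iff_complex intro!: sum_nonneg)

text \<open>Summing \<open>tr \<gamma> \<ge> tr J\<^sub>x\<close> over the outcomes, where
  \<open>\<Sum>\<^sub>x tr J\<^sub>x = CARD('a0)\<close> by trace preservation, bounds the guessing
  probability below by \<open>1 / CARD('b1)\<close>. Positivity is what lets the logarithm in
  \<open>H_min_ext\<close> be inverted.\<close>

lemma P_guess_given_pos:
  fixes W :: "'b1::finite \<Rightarrow> 'b0::finite \<Rightarrow> 'a0::finite op \<Rightarrow> 'a1::finite op"
  assumes cp: "\<And>x. completely_positive (W x y)"
    and qc: "quantum_channel (\<lambda>\<rho>. \<Sum>x\<in>UNIV. W x y \<rho>)"
  shows "0 < P_guess_given W y"
proof -
  obtain \<gamma> where \<gamma>: "\<And>x. op_ge \<gamma> (choi (W x y))" "ptrace_snd \<gamma> = P_guess_given W y *\<^sub>R mat 1"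
    using P_guess_given_dual(1)[of W y] cp by blast
  have t: "Re (trace \<gamma>) = P_guess_given W y * CARD('a0)"
    unfolding trace_ptrace_snd[of \<gamma>, symmetric] \<gamma>(2) trace_scaleR trace_mat1 by simp
  have "Re (trace (choi (W x y))) \<le> P_guess_given W y * CARD('a0)" for x
    using trace_psd_nonneg \<gamma>(1)[of x] unfolding op_ge_def t[symmetric] by (fastforce simp: trace_sub)
  then have "(\<Sum>x\<in>UNIV. Re (trace (choi (W x y)))) \<le> (\<Sum>x\<in>(UNIV :: 'b1 set). P_guess_given W y * CARD('a0))"
    by (intro sum_mono)
  moreover have "(\<Sum>x\<in>UNIV. trace (choi (W x y))) = of_nat CARD('a0)"
  proof -
    have "(\<Sum>x\<in>UNIV. trace (choi (W x y)))
       = (\<Sum>a\<in>UNIV. \<Sum>x\<in>UNIV. trace (W x y (outer (axis a 1) (axis a 1))))"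
      by (subst sum.swap) (simp add: trace_def choi_def sum_UNIV_pair)
    also have "\<dots> = (\<Sum>a\<in>UNIV. trace (outer (axis a 1) (axis a 1) :: 'a0 op))"
      using qc by (simp add: quantum_channel_def flip: trace_sum)
    also have "\<dots> = (\<Sum>a\<in>(UNIV :: 'a0 set). 1)"
      by (intro sum.cong refl) (simp add: trace_def outer_def axis_def if_distrib[of "\<lambda>x. x * _"] if_distrib[of cnj] cong: if_cong)
    finally show ?thesis by simp
  qed
  then have "(\<Sum>x\<in>UNIV. Re (trace (choi (W x y)))) = real CARD('a0)"
    by (simp flip: Re_sum)
  ultimately have "real CARD('a0) \<le> real CARD('b1) * (P_guess_given W y * CARD('a0))"
    by simp
  moreover have "0 < real CARD('a0)" by simp
  ultimately have "0 < real CARD('b1) * (P_guess_given W y * CARD('a0))"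
    by (rule less_le_trans[rotated])
  then show ?thesis by (simp add: zero_less_mult_iff)
qed

text \<open>The diagonal block \<open>B\<close> of \<open>\<gamma>\<close> at \<open>y\<close>,
  scaled by \<open>c\<close>, is dual feasible for that \<open>y\<close>: the marginal condition
  makes its partial trace \<open>CARD('b0) * T y\<close> times the identity, with \<open>T y\<close>
  the diagonal entry of the \<open>B\<^sub>0\<close> marginal. Averaging over \<open>y\<close> turns
  these bounds into \<open>tr \<gamma>\<close>.\<close>

lemma P_guess_le_trace:
  fixes \<Omega> :: "('a0::finite \<times> 'b0::finite) op \<Rightarrow> ('a1::finite \<times> 'b1::finite) op"
  assumes W: "B_classical \<Omega> W"
    and \<gamma>: "hermitian \<gamma>" "op_ge (kron \<gamma> (mat 1)) (choi_state \<Omega>)"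
      "marginal_A0B0 \<gamma> = kron max_mixed (ptrace_fst \<gamma>)"
  shows "P_guess W \<le> Re (trace \<gamma>)"
proof -
  define c where "c = real CARD('a0) * real CARD('b0)"
  have c: "c > 0" by (simp add: c_def)
  define T where "T = (\<lambda>y. Re (ptrace_fst \<gamma> $ y $ y))"
  have "P_guess_given W y \<le> CARD('b0) * T y" for y
  proof -
    define B where "B = reindex (\<lambda>p. (p, y)) \<gamma>"
    have "op_ge (c *\<^sub>R B) (choi (W x y))" for x
    proof -
      have "reindex (\<lambda>p. ((p, y), x)) (kron \<gamma> (mat 1) - choi_state \<Omega>) = B - (1 / c) *\<^sub>R choi (W x y)"
        unfolding vec_eq_iff vector_minus_component scaleR_entry
        by (simp add: reindex_def B_def kron_def mat_def choi_state_entry[OF W] c_def)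
      moreover have "psd (reindex (\<lambda>p. ((p, y), x)) (kron \<gamma> (mat 1) - choi_state \<Omega>))"
        using \<gamma>(2) by (intro psd_reindex) (auto simp: op_ge_def inj_def)
      ultimately have "psd (c *\<^sub>R (B - (1 / c) *\<^sub>R choi (W x y)))"
        using c by (simp add: psd_scaleR)
      then show ?thesis using c by (simp add: op_ge_def scaleR_diff_right)
    qed
    moreover have "ptrace_snd (c *\<^sub>R B) = (CARD('b0) * T y) *\<^sub>R mat 1"
    proof -
      have "Im (ptrace_fst \<gamma> $ y $ y) = 0"
      proof -
        have "Im (\<gamma> $ p $ p) = 0" for p
        proof -
          have "adj \<gamma> $ p $ p = \<gamma> $ p $ p" using \<gamma>(1) by (simp add: hermitian_iff_adj)
          then show ?thesis by (simp add: adj_def complex_eq_iff)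
        qed
        then show ?thesis by (simp add: ptrace_fst_def)
      qed
      then have T: "ptrace_fst \<gamma> $ y $ y = of_real (T y)" by (simp add: T_def complex_eq_iff)
      have "ptrace_snd B $ a $ a' = of_real (T y / CARD('a0)) * mat 1 $ a $ a'" for a a'
      proof -
        have "ptrace_snd B $ a $ a' = marginal_A0B0 \<gamma> $ (a, y) $ (a', y)"
          by (simp add: B_def ptrace_snd_def reindex_def marginal_A0B0_def)
        also have "\<dots> = of_real (T y / CARD('a0)) * mat 1 $ a $ a'"
          unfolding \<gamma>(3) by (simp add: kron_def T max_mixed_def scaleR_entry del: vector_scaleR_component)
        finally show ?thesis .
      qed
      then show ?thesis
        unfolding ptrace_snd_scaleR vec_eq_iff scaleR_entry by (simp add: c_def)
    qed
    ultimately show ?thesis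
      using W by (intro P_guess_given_dual(2)) (auto simp: B_classical_def)
  qed
  then have "(\<Sum>y\<in>UNIV. P_guess_given W y) \<le> (\<Sum>y\<in>UNIV. CARD('b0) * T y)" by (rule sum_mono)
  also have "\<dots> = CARD('b0) * Re (trace \<gamma>)"
  proof -
    have "trace \<gamma> = (\<Sum>y\<in>UNIV. ptrace_fst \<gamma> $ y $ y)"
      unfolding trace_def sum_UNIV_pair[of "\<lambda>r :: ('a0 \<times> 'a1) \<times> 'b0. _ r"]
      by (subst sum.swap) (simp add: ptrace_fst_def)
    then show ?thesis by (simp add: T_def sum_distrib_left)
  qed
  finally show ?thesis by (simp add: P_guess_def field_simps)
qed

text \<open>Converse assembly: the optimal dual operators \<open>g y\<close>, scaled by
  \<open>1 / c\<close>, are placed as diagonal blocks. The operator inequality then splits over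
  \<open>y\<close> and \<open>x\<close>, and the trace is the average of the individual
  values.\<close>

lemma P_guess_attained:
  fixes \<Omega> :: "('a0::finite \<times> 'b0::finite) op \<Rightarrow> ('a1::finite \<times> 'b1::finite) op"
  assumes W: "B_classical \<Omega> W"
  obtains \<gamma> where "hermitian \<gamma>" "op_ge (kron \<gamma> (mat 1)) (choi_state \<Omega>)"
      "marginal_A0B0 \<gamma> = kron max_mixed (ptrace_fst \<gamma>)" "P_guess W = Re (trace \<gamma>)"
proof -
  define c where "c = real CARD('a0) * real CARD('b0)"
  have c: "c > 0" by (simp add: c_def)
  have "\<exists>\<gamma>. hermitian \<gamma> \<and> (\<forall>x. op_ge \<gamma> (choi (W x y))) \<and> ptrace_snd \<gamma> = P_guess_given W y *\<^sub>R mat 1" for y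
    using W by (intro P_guess_given_dual(1)) (auto simp: B_classical_def)
  then obtain g where g: "\<And>y. hermitian (g y)" "\<And>x y. op_ge (g y) (choi (W x y))"
    "\<And>y. ptrace_snd (g y) = P_guess_given W y *\<^sub>R mat 1"
    by metis
  have tr: "trace (g y) = of_real (P_guess_given W y * CARD('a0))" for y
    unfolding trace_ptrace_snd[of "g y", symmetric] g(3) trace_scaleR trace_mat1 by simp
  define \<gamma> :: "(('a0 \<times> 'a1) \<times> 'b0) op" where
    "\<gamma> = (\<chi> p q. if snd p = snd q then of_real (1 / c) * g (snd p) $ fst p $ fst q else 0)"
  have herm: "hermitian \<gamma>"
    using g(1) by (auto simp: \<gamma>_def hermitian_def vec_eq_iff)
  have "cip w ((kron \<gamma> (mat 1) - choi_state \<Omega>) *v w) =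
      (\<Sum>y\<in>UNIV. \<Sum>x\<in>UNIV. of_real (1 / c) * cip (\<chi> p. w $ ((p, y), x)) ((g y - choi (W x y)) *v (\<chi> p. w $ ((p, y), x))))" for w
  proof -
    have "cip w ((kron \<gamma> (mat 1) - choi_state \<Omega>) *v w) =
      (\<Sum>p\<in>UNIV. \<Sum>y\<in>UNIV. \<Sum>x\<in>UNIV. \<Sum>q\<in>UNIV. \<Sum>y'\<in>UNIV. \<Sum>x'\<in>UNIV.
        cnj (w $ ((p, y), x)) * (kron \<gamma> (mat 1) - choi_state \<Omega>) $ ((p, y), x) $ ((q, y'), x') * w $ ((q, y'), x'))"
      unfolding cip_matrix sum_UNIV_pair[of "\<lambda>r :: (('a0 \<times> 'a1) \<times> 'b0) \<times> 'b1. _ r"]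
        sum_UNIV_pair[of "\<lambda>r :: ('a0 \<times> 'a1) \<times> 'b0. _ r"] ..
    also have "\<dots> = (\<Sum>p\<in>UNIV. \<Sum>y\<in>UNIV. \<Sum>x\<in>UNIV. \<Sum>q\<in>UNIV. \<Sum>y'\<in>UNIV. \<Sum>x'\<in>UNIV.
        if x' = x then if y' = y then of_real (1 / c) * (cnj (w $ ((p, y), x)) * (g y - choi (W x y)) $ p $ q * w $ ((q, y), x)) else 0 else 0)"
      by (intro sum.cong refl) (auto simp: kron_def mat_def \<gamma>_def choi_state_entry[OF W] c_def algebra_simps)
    also have "\<dots> = (\<Sum>p\<in>UNIV. \<Sum>y\<in>UNIV. \<Sum>x\<in>UNIV. \<Sum>q\<in>UNIV.
        of_real (1 / c) * (cnj (w $ ((p, y), x)) * (g y - choi (W x y)) $ p $ q * w $ ((q, y), x)))"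
      by (simp only: sum.delta finite UNIV_I if_True)
    also have "\<dots> = (\<Sum>y\<in>UNIV. \<Sum>x\<in>UNIV. \<Sum>p\<in>UNIV. \<Sum>q\<in>UNIV.
        of_real (1 / c) * (cnj (w $ ((p, y), x)) * (g y - choi (W x y)) $ p $ q * w $ ((q, y), x)))"
      by (subst sum.swap) (rule sum.cong[OF refl sum.swap])
    finally show ?thesis unfolding cip_matrix by (simp add: sum_distrib_left)
  qed
  note blocks = this
  have ge: "op_ge (kron \<gamma> (mat 1)) (choi_state \<Omega>)"
    unfolding op_ge_def psd_def blocks
  proof (intro allI)
    fix w :: "complex ^ ((('a0 \<times> 'a1) \<times> 'b0) \<times> 'b1)"
    have "cip v ((g y - choi (W x y)) *v v) \<in> \<real>\<^sub>\<ge>\<^sub>0" for v x y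
      using g(2)[of y x] by (simp add: op_ge_def psd_def)
    then show "(\<Sum>y\<in>UNIV. \<Sum>x\<in>UNIV. of_real (1 / c) * cip (\<chi> p. w $ ((p, y), x)) ((g y - choi (W x y)) *v (\<chi> p. w $ ((p, y), x)))) \<in> \<real>\<^sub>\<ge>\<^sub>0"
      using c by (auto simp: nonneg_Reals_iff_complex intro!: sum_nonneg)
  qed
  have "trace \<gamma> = (\<Sum>y\<in>UNIV. of_real (1 / c) * trace (g y))"
    unfolding trace_def sum_UNIV_pair[of "\<lambda>r :: ('a0 \<times> 'a1) \<times> 'b0. _ r"]
    by (subst sum.swap) (simp add: \<gamma>_def sum_distrib_left)
  then have val: "P_guess W = Re (trace \<gamma>)"
    by (simp add: tr P_guess_def c_def sum_divide_distrib)
  \<comment> \<open>Within a block, \<open>ptrace_snd (g y)\<close> is a multiple of the identity,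
    which is the uniform marginal on \<open>A\<^sub>0\<close>; between different blocks both sides
    vanish.\<close>
  have "marginal_A0B0 \<gamma> = kron max_mixed (ptrace_fst \<gamma>)"
  proof -
    have "marginal_A0B0 \<gamma> $ (a, y) $ (a', y') = kron max_mixed (ptrace_fst \<gamma>) $ (a, y) $ (a', y')" for a y a' y'
    proof (cases "y = y'")
      case True
      have "marginal_A0B0 \<gamma> $ (a, y) $ (a', y') = of_real (1 / c) * ptrace_snd (g y) $ a $ a'"
        by (simp add: True marginal_A0B0_def ptrace_snd_def reindex_def \<gamma>_def sum_distrib_left)
      also have "\<dots> = of_real (1 / c) * of_real (P_guess_given W y) * mat 1 $ a $ a'"
        unfolding g(3) scaleR_entry by simp
      also have "\<dots> = of_real (1 / CARD('a0)) * mat 1 $ a $ a' * (of_real (1 / c) * trace (g y))"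
        by (simp add: tr)
      also have "of_real (1 / c) * trace (g y) = ptrace_fst \<gamma> $ y $ y"
        by (simp add: ptrace_fst_def \<gamma>_def trace_def sum_distrib_left)
      finally show ?thesis
        by (simp add: kron_def True max_mixed_def scaleR_entry del: vector_scaleR_component)
    qed (simp add: marginal_A0B0_def ptrace_snd_def reindex_def \<gamma>_def kron_def ptrace_fst_def)
    then show ?thesis by (simp add: vec_eq_iff)
  qed
  with herm ge show ?thesis using val by (rule that)
qed

theorem theorem6:
  fixes \<Omega> :: "('a0::finite \<times> 'b0::finite) op \<Rightarrow> ('a1::finite \<times> 'b1::finite) op"
    and W :: "'b1 \<Rightarrow> 'b0 \<Rightarrow> 'a0 op \<Rightarrow> 'a1 op"
  assumes "quantum_channel \<Omega>"
    and "B_classical \<Omega> W"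
  shows "P_guess W = 2 powr (- H_min_ext \<Omega>)"
proof -
  note W = assms(2)
  have "H_min_ext \<Omega> = - log 2 (P_guess W)"
    unfolding H_min_ext_def
  proof (rule arg_cong[of _ _ "\<lambda>t. - log 2 t"], rule Least_equality)
    show "\<exists>\<gamma>. hermitian \<gamma> \<and> op_ge (kron \<gamma> (mat 1)) (choi_state \<Omega>) \<and>
        marginal_A0B0 \<gamma> = kron max_mixed (ptrace_fst \<gamma>) \<and> P_guess W = Re (trace \<gamma>)"
      using P_guess_attained[OF W] by metis
    show "P_guess W \<le> t" if "\<exists>\<gamma>. hermitian \<gamma> \<and> op_ge (kron \<gamma> (mat 1)) (choi_state \<Omega>) \<and>
        marginal_A0B0 \<gamma> = kron max_mixed (ptrace_fst \<gamma>) \<and> t = Re (trace \<gamma>)" for t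
      using that P_guess_le_trace[OF W] by auto
  qed
  \<comment> \<open>Needed for \<open>2 powr log 2 (P_guess W) = P_guess W\<close>.\<close>
  moreover have "P_guess W > 0"
    unfolding P_guess_def using W
    by (intro mult_pos_pos sum_pos P_guess_given_pos) (auto simp: B_classical_def)
  ultimately show ?thesis by simp
qed

end
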